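(* Let $R$ be a Noetherian super-ring with $\mathrm{Kdim}(R_0)<\infty$ and let $M$ be a nonzero $R$-supermodule. Let $y_1,\dots,y_t\in R_1$ with $t\ge1$, and set $I=Ry_1+\dots+Ry_t$. (1) If $y_1,\dots,y_t$ is a fragment (subcollection) of a longest system of odd parameters of $M$, then $$\mathrm{sdim}_0(M)=\mathrm{sdim}_0(IM)=\mathrm{sdim}_0(M/IM),$$ $$\mathrm{sdim}_1(M)\ge\mathrm{sdim}_1(IM)\ge\mathrm{sdim}_1(M)-1,\qquad \mathrm{sdim}_1(M/IM)\ge\mathrm{sdim}_1(M)-t.$$ (2) If $y_1,\dots,y_t$ is an odd $M$-regular sequence, then $\mathrm{sdim}_1(M)\ge t$ and $$\mathrm{sdim}_1(M/IM)=\mathrm{sdim}_1(y_1\cdots y_tM)\le\mathrm{sdim}_1(M)-t.$$ Moreover, $\mathrm{sdim}_1(M/IM)=\mathrm{sdim}_1(M)-t$ if and only if $y_1,\dots,y_t$ can be extended to a longest system of odd parameters of $M$.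
   Context: A super-ring is a unital associative $\mathbb{Z}_2$-graded ring $R=R_0\oplus R_1$; all super-rings are super-commutative ($ab=(-1)^{|a||b|}ba$ for homogeneous $a,b$, and $a^2=0$ for odd $a$). Supermodules are $\mathbb{Z}_2$-graded modules. Noetherian means the ascending chain condition on superideals ($\mathbb{Z}_2$-graded ideals). For a nonzero $R$-supermodule $N$: $\dim(N)=\mathrm{Kdim}(R_0/\mathrm{Ann}_{R_0}(N))$ (with $\dim(0)=-\infty$); $\mathrm{sdim}_0(N)=\dim(N)$; a collection $y_1,\dots,y_l\in R_1$ ($l\ge1$) is a system of odd parameters of $N$ if $\dim(y_1\cdots y_lN)=\dim(N)$; $\mathrm{sdim}_1(N)$ is the largest length of a system of odd parameters of $N$, or $0$ if there is none. A system of odd parameters of $N$ is longest if its length is $\mathrm{sdim}_1(N)$. An odd element $r\in R_1$ is $N$-regular if the kernel of $N\to N$, $m\mapsto rm$, equals $rN$. A sequence $r_1,\dots,r_t\in R_1$ is $N$-regular if each $r_i$ is $N/(Rr_1+\dots+Rr_{i-1})N$-regular. *)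

theory Defs
  imports
    "HOL-Algebra.QuotRing"
    "HOL-Algebra.Module"
    "HOL-Library.Extended_Real"
    "HOL-Library.Multiset"
begin

section \<open>Super-rings and supermodules\<close>

record 'a superring = "'a ring" +
  ring_ev :: "'a set"
  ring_od :: "'a set"

definition graded_split :: "('a, 'm) ring_scheme \<Rightarrow> 'a set \<Rightarrow> 'a set \<Rightarrow> 'a set \<Rightarrow> bool" where
  "graded_split G A A0 A1 \<longleftrightarrow>
     additive_subgroup A0 G \<and> additive_subgroup A1 G \<and>
     A = A0 <+>\<^bsub>G\<^esub> A1 \<and> A0 \<inter> A1 = {\<zero>\<^bsub>G\<^esub>}"

text \<open>Super-commutativity is part of the notion of super-ring.\<close>

locale super_ring = ring R for R :: "('a, 'm) superring_scheme" (structure) +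
  assumes grading: "graded_split R (carrier R) (ring_ev R) (ring_od R)"
    and ev_ev: "\<lbrakk>a \<in> ring_ev R; b \<in> ring_ev R\<rbrakk> \<Longrightarrow> a \<otimes> b \<in> ring_ev R"
    and ev_od: "\<lbrakk>a \<in> ring_ev R; b \<in> ring_od R\<rbrakk> \<Longrightarrow> a \<otimes> b \<in> ring_od R"
    and od_ev: "\<lbrakk>a \<in> ring_od R; b \<in> ring_ev R\<rbrakk> \<Longrightarrow> a \<otimes> b \<in> ring_od R"
    and od_od: "\<lbrakk>a \<in> ring_od R; b \<in> ring_od R\<rbrakk> \<Longrightarrow> a \<otimes> b \<in> ring_ev R"
    and ev_central: "\<lbrakk>a \<in> ring_ev R; b \<in> ring_ev R \<union> ring_od R\<rbrakk> \<Longrightarrow> a \<otimes> b = b \<otimes> a"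
    and od_anticomm: "\<lbrakk>a \<in> ring_od R; b \<in> ring_od R\<rbrakk> \<Longrightarrow> a \<otimes> b = \<ominus> (b \<otimes> a)"
    and od_square: "a \<in> ring_od R \<Longrightarrow> a \<otimes> a = \<zero>"

abbreviation even_ring :: "('a, 'm) superring_scheme \<Rightarrow> ('a, 'm) superring_scheme" where
  "even_ring R \<equiv> R\<lparr>carrier := ring_ev R\<rparr>"

definition superideal :: "('a, 'm) superring_scheme \<Rightarrow> 'a set \<Rightarrow> bool" where
  "superideal R I \<longleftrightarrow> ideal I R \<and> graded_split R I (I \<inter> ring_ev R) (I \<inter> ring_od R)"

definition super_noetherian :: "('a, 'm) superring_scheme \<Rightarrow> bool" where
  "super_noetherian R \<longleftrightarrow>
     (\<forall>J :: nat \<Rightarrow> 'a set.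
        (\<forall>n. superideal R (J n)) \<and> (\<forall>n. J n \<subseteq> J (Suc n)) \<longrightarrow> (\<exists>N. \<forall>n\<ge>N. J n = J N))"

text \<open>The multiplication and unit of the underlying \<^typ>\<open>('a, 'b) module\<close> record play no role,
  as for the modules of \<^theory>\<open>HOL-Algebra.Module\<close>; the locale \<^locale>\<open>module\<close> of that theory
  itself is not applicable, because it requires a commutative ring of scalars.\<close>

record ('a, 'b) supermodule = "('a, 'b) module" +
  mod_ev :: "'b set"
  mod_od :: "'b set"

locale super_module = R?: super_ring R + M?: abelian_group M
  for R :: "('a, 'm) superring_scheme" (structure)
    and M :: "('a, 'b, 'n) supermodule_scheme" (structure) +
  assumes smult_closed: "\<lbrakk>a \<in> carrier R; x \<in> carrier M\<rbrakk> \<Longrightarrow> a \<odot>\<^bsub>M\<^esub> x \<in> carrier M"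
    and smult_l_distr: "\<lbrakk>a \<in> carrier R; b \<in> carrier R; x \<in> carrier M\<rbrakk> \<Longrightarrow>
          (a \<oplus> b) \<odot>\<^bsub>M\<^esub> x = a \<odot>\<^bsub>M\<^esub> x \<oplus>\<^bsub>M\<^esub> b \<odot>\<^bsub>M\<^esub> x"
    and smult_r_distr: "\<lbrakk>a \<in> carrier R; x \<in> carrier M; y \<in> carrier M\<rbrakk> \<Longrightarrow>
          a \<odot>\<^bsub>M\<^esub> (x \<oplus>\<^bsub>M\<^esub> y) = a \<odot>\<^bsub>M\<^esub> x \<oplus>\<^bsub>M\<^esub> a \<odot>\<^bsub>M\<^esub> y"
    and smult_assoc: "\<lbrakk>a \<in> carrier R; b \<in> carrier R; x \<in> carrier M\<rbrakk> \<Longrightarrow>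
          (a \<otimes> b) \<odot>\<^bsub>M\<^esub> x = a \<odot>\<^bsub>M\<^esub> (b \<odot>\<^bsub>M\<^esub> x)"
    and smult_one: "x \<in> carrier M \<Longrightarrow> \<one> \<odot>\<^bsub>M\<^esub> x = x"
    and mod_grading: "graded_split M (carrier M) (mod_ev M) (mod_od M)"
    and smult_ev_ev: "\<lbrakk>a \<in> ring_ev R; x \<in> mod_ev M\<rbrakk> \<Longrightarrow> a \<odot>\<^bsub>M\<^esub> x \<in> mod_ev M"
    and smult_ev_od: "\<lbrakk>a \<in> ring_ev R; x \<in> mod_od M\<rbrakk> \<Longrightarrow> a \<odot>\<^bsub>M\<^esub> x \<in> mod_od M"
    and smult_od_ev: "\<lbrakk>a \<in> ring_od R; x \<in> mod_ev M\<rbrakk> \<Longrightarrow> a \<odot>\<^bsub>M\<^esub> x \<in> mod_od M"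
    and smult_od_od: "\<lbrakk>a \<in> ring_od R; x \<in> mod_od M\<rbrakk> \<Longrightarrow> a \<odot>\<^bsub>M\<^esub> x \<in> mod_ev M"


section \<open>Subsupermodules and quotients\<close>

definition sub_supermod :: "('a, 'b) supermodule \<Rightarrow> 'b set \<Rightarrow> ('a, 'b) supermodule" where
  "sub_supermod M K = M\<lparr>carrier := K, mod_ev := K \<inter> mod_ev M, mod_od := K \<inter> mod_od M\<rparr>"

definition quot_supermod :: "('a, 'b) supermodule \<Rightarrow> 'b set \<Rightarrow> ('a, 'b set) supermodule" where
  "quot_supermod M K =
     \<lparr>carrier = a_rcosets\<^bsub>M\<^esub> K, monoid.mult = undefined, one = undefined,
      ring.zero = K, add = set_add M,
      smult = (\<lambda>a C. \<Union>x\<in>C. K +>\<^bsub>M\<^esub> (a \<odot>\<^bsub>M\<^esub> x)),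
      mod_ev = (\<lambda>x. K +>\<^bsub>M\<^esub> x) ` mod_ev M,
      mod_od = (\<lambda>x. K +>\<^bsub>M\<^esub> x) ` mod_od M\<rparr>"

text \<open>\<open>R y\<^sub>1 + \<dots> + R y\<^sub>t\<close>; the zero ideal if \<open>ys\<close> is empty.\<close>

definition gen_ideal :: "('a, 'm) superring_scheme \<Rightarrow> 'a list \<Rightarrow> 'a set" where
  "gen_ideal R ys =
     {\<Oplus>\<^bsub>R\<^esub>i\<in>{..<length ys}. c i \<otimes>\<^bsub>R\<^esub> ys ! i | c. c \<in> {..<length ys} \<rightarrow> carrier R}"

text \<open>\<open>IM\<close> consists of all finite sums of products.\<close>

definition ideal_smult :: "'a set \<Rightarrow> ('a, 'b) supermodule \<Rightarrow> 'b set" where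
  "ideal_smult I M =
     {\<Oplus>\<^bsub>M\<^esub>k\<in>{..<n}. a k \<odot>\<^bsub>M\<^esub> x k | (n::nat) a x. a \<in> {..<n} \<rightarrow> I \<and> x \<in> {..<n} \<rightarrow> carrier M}"

text \<open>The supermodules \<open>IM\<close>, \<open>M/IM\<close> and \<open>y\<^sub>1 \<cdots> y\<^sub>l M\<close>.\<close>

definition ideal_mod :: "'a set \<Rightarrow> ('a, 'b) supermodule \<Rightarrow> ('a, 'b) supermodule" where
  "ideal_mod I M = sub_supermod M (ideal_smult I M)"

definition quot_mod :: "('a, 'b) supermodule \<Rightarrow> 'a set \<Rightarrow> ('a, 'b set) supermodule" where
  "quot_mod M I = quot_supermod M (ideal_smult I M)"

definition list_prod :: "('a, 'm) superring_scheme \<Rightarrow> 'a list \<Rightarrow> 'a" where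
  "list_prod R ys = foldr (\<otimes>\<^bsub>R\<^esub>) ys \<one>\<^bsub>R\<^esub>"

definition prod_mod ::
  "('a, 'm) superring_scheme \<Rightarrow> 'a list \<Rightarrow> ('a, 'b) supermodule \<Rightarrow> ('a, 'b) supermodule" where
  "prod_mod R ys M = sub_supermod M ((\<lambda>x. list_prod R ys \<odot>\<^bsub>M\<^esub> x) ` carrier M)"


section \<open>Dimensions and odd parameters\<close>

text \<open>Krull dimension with values in \<^typ>\<open>ereal\<close>: the supremum of the lengths of chains of prime
  ideals.  The zero ring has no prime ideals and therefore dimension \<open>-\<infinity>\<close>; this also yields the
  convention \<open>dim 0 = -\<infinity>\<close> for the dimension of modules.\<close>

definition Kdim :: "('a, 'm) ring_scheme \<Rightarrow> ereal" where
  "Kdim A = Sup {ereal (real n) | n.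
     \<exists>P :: nat \<Rightarrow> 'a set. (\<forall>i\<le>n. primeideal (P i) A) \<and> (\<forall>i<n. P i \<subset> P (Suc i))}"

definition ann_ev :: "('a, 'm) superring_scheme \<Rightarrow> ('a, 'b) supermodule \<Rightarrow> 'a set" where
  "ann_ev R N = {r \<in> ring_ev R. \<forall>x\<in>carrier N. r \<odot>\<^bsub>N\<^esub> x = \<zero>\<^bsub>N\<^esub>}"

definition sdim0 :: "('a, 'm) superring_scheme \<Rightarrow> ('a, 'b) supermodule \<Rightarrow> ereal" where
  "sdim0 R N = Kdim (even_ring R Quot ann_ev R N)"

definition odd_params ::
  "('a, 'm) superring_scheme \<Rightarrow> ('a, 'b) supermodule \<Rightarrow> 'a list \<Rightarrow> bool" where
  "odd_params R N ys \<longleftrightarrow>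
     ys \<noteq> [] \<and> set ys \<subseteq> ring_od R \<and> sdim0 R (prod_mod R ys N) = sdim0 R N"

text \<open>If \<open>R\<close> is Noetherian and \<open>N \<noteq> 0\<close> then the set below is finite: \<open>R\<close> is generated over its even
  part by finitely many odd elements, so a longer product of odd elements vanishes, and the
  zero module has dimension \<open>-\<infinity>\<close> whereas \<open>N\<close> has not.  Only this case is meaningful.\<close>

definition sdim1 :: "('a, 'm) superring_scheme \<Rightarrow> ('a, 'b) supermodule \<Rightarrow> nat" where
  "sdim1 R N = Max (insert 0 {length ys | ys. odd_params R N ys})"

definition longest_odd_params ::
  "('a, 'm) superring_scheme \<Rightarrow> ('a, 'b) supermodule \<Rightarrow> 'a list \<Rightarrow> bool" where
  "longest_odd_params R N ys \<longleftrightarrow> odd_params R N ys \<and> length ys = sdim1 R N"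

text \<open>Systems of parameters are unordered collections, possibly with repetitions a priori, so
  fragments are sub-multisets.\<close>

definition fragment_of_longest ::
  "('a, 'm) superring_scheme \<Rightarrow> ('a, 'b) supermodule \<Rightarrow> 'a list \<Rightarrow> bool" where
  "fragment_of_longest R N ys \<longleftrightarrow> (\<exists>zs. longest_odd_params R N zs \<and> mset ys \<subseteq># mset zs)"


section \<open>Odd regular sequences\<close>

definition odd_regular ::
  "('a, 'm) superring_scheme \<Rightarrow> ('a, 'b) supermodule \<Rightarrow> 'a \<Rightarrow> bool" where
  "odd_regular R N r \<longleftrightarrow>
     r \<in> ring_od R \<and>
     {x \<in> carrier N. r \<odot>\<^bsub>N\<^esub> x = \<zero>\<^bsub>N\<^esub>} = (\<lambda>x. r \<odot>\<^bsub>N\<^esub> x) ` carrier N"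

definition odd_regular_seq ::
  "('a, 'm) superring_scheme \<Rightarrow> ('a, 'b) supermodule \<Rightarrow> 'a list \<Rightarrow> bool" where
  "odd_regular_seq R N rs \<longleftrightarrow>
     (\<forall>i<length rs. odd_regular R (quot_mod N (gen_ideal R (take i rs))) (rs ! i))"

end

theory Submission
  imports Defs "HOL-Algebra.Ring_Divisibility" "HOL-Algebra.Subrings"
begin

text \<open>
  Every dimension involved is the Krull dimension of \<open>R\<^sub>0\<close> modulo an annihilator, and it only depends
  on the annihilator up to radical. An odd \<open>y\<close> satisfies \<open>y R y = 0\<close>, so an even \<open>r\<close> with
  \<open>r M \<subseteq> I M\<close> acts nilpotently on \<open>M\<close>, whence \<open>dim (M/IM) = dim M\<close>; the other comparisons follow
  from inclusions of annihilators, since reordering a product of odd elements only changes its sign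
  and \<open>y\<^sub>1 \<cdots> y\<^sub>t\<close> kills \<open>I M\<close>. For an \<open>M\<close>-regular sequence \<open>I M\<close> is exactly the kernel of
  \<open>y\<^sub>1 \<cdots> y\<^sub>t\<close>, so that \<open>M/IM\<close> and \<open>y\<^sub>1 \<cdots> y\<^sub>t M\<close> have the same annihilators, also after multiplication
  with further odd elements. The lengths of systems of odd parameters are bounded because the odd
  part of a Noetherian super-ring generates a nilpotent ideal, and because a nonzero module
  has dimension \<open>\<noteq> -\<infinity>\<close>.\<close>

section \<open>Krull dimension of quotients\<close>

text \<open>Stated in \<open>R\<close> itself, so that chains belonging to different ideals
  \<open>J\<close> can be compared without passing between quotient rings.\<close>

definition prime_chain_above :: "('a, 'm) ring_scheme \<Rightarrow> 'a set \<Rightarrow> nat \<Rightarrow> bool" where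
  "prime_chain_above R J n \<longleftrightarrow>
     (\<exists>P :: nat \<Rightarrow> 'a set. (\<forall>i\<le>n. primeideal (P i) R \<and> J \<subseteq> P i) \<and> (\<forall>i<n. P i \<subset> P (Suc i)))"

lemma (in primeideal) pow_memD:
  assumes "a \<in> carrier R" "a [^] (n::nat) \<in> I"
  shows "a \<in> I"
  using assms(2)
proof (induction n)
  case 0
  then show ?case using I_notcarr one_imp_carrier by simp
next
  case (Suc n)
  then show ?case using I_prime[of "a [^] n" a] assms(1) by auto
qed

text \<open>Zorn's lemma for the ideals above \<open>J\<close> that avoid \<open>\<one>\<close>: the
  union of a nonempty chain of them is again one, and a maximal element is a maximal ideal, hence
  prime.\<close>

lemma (in cring) exists_primeideal_above:
  assumes "ideal J R" "J \<noteq> carrier R"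
  shows "\<exists>P. primeideal P R \<and> J \<subseteq> P"
proof -
  define S where "S = {I. ideal I R \<and> J \<subseteq> I \<and> \<one> \<notin> I}"
  have JS: "J \<in> S"
    using assms ideal.one_imp_carrier unfolding S_def by blast
  have "\<exists>P\<in>S. \<forall>X\<in>S. P \<subseteq> X \<longrightarrow> X = P"
  proof (rule subset_Zorn)
    fix C assume C: "subset.chain S C"
    show "\<exists>U\<in>S. \<forall>X\<in>C. X \<subseteq> U"
    proof (cases "C = {}")
      case False
      have CS: "C \<subseteq> S" using C by (simp add: pred_on.chain_def)
      have "subset.chain {I. ideal I R} C"
        using C unfolding pred_on.chain_def S_def by auto
      then have "ideal (\<Union>C) R"
        using chain_Union_is_ideal[of C] False by simp
      then have "\<Union>C \<in> S" using CS False unfolding S_def by blast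
      then show ?thesis by blast
    qed (use JS in auto)
  qed
  then obtain P where P: "P \<in> S" and maxP: "\<And>X. X \<in> S \<Longrightarrow> P \<subseteq> X \<Longrightarrow> X = P" by blast
  have "maximalideal P R"
  proof (rule maximalidealI)
    show "ideal P R" using P by (simp add: S_def)
    show "carrier R \<noteq> P" using P by (auto simp: S_def)
    fix X assume X: "ideal X R" "P \<subseteq> X" "X \<subseteq> carrier R"
    show "X = P \<or> X = carrier R"
    proof (cases "\<one> \<in> X")
      case True then show ?thesis using X ideal.one_imp_carrier by blast
    next
      case False then have "X \<in> S" using X P by (auto simp: S_def)
      then show ?thesis using maxP X by blast
    qed
  qed
  then show ?thesis using maximalideal_prime P by (auto simp: S_def)
qed

section \<open>Prime ideals and Krull dimension of a quotient ring\<close>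

context cring
begin

text \<open>Because \<open>J \<subseteq> P\<close>, membership in \<open>P\<close> is constant on
  cosets of \<open>J\<close>. This is what carries primality down to the quotient.\<close>

lemma proj_mem_iff:
  assumes "ideal J R" "ideal P R" "J \<subseteq> P" "a \<in> carrier R"
  shows "J +> a \<in> (+>) J ` P \<longleftrightarrow> a \<in> P"
proof
  assume "J +> a \<in> (+>) J ` P"
  then obtain p where p: "p \<in> P" "J +> a = J +> p" by auto
  interpret J: ideal J R by fact
  interpret P: ideal P R by fact
  have "a \<in> J +> p" using p(2) J.a_rcos_self[OF assms(4)] by simp
  then obtain j where "j \<in> J" "a = j \<oplus> p" unfolding a_r_coset_def' by auto
  then show "a \<in> P" using p(1) assms(3) by blast
qed simp

lemma primeideal_image_proj:
  assumes J: "ideal J R" and P: "primeideal P R" and JP: "J \<subseteq> P"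
  shows "primeideal ((+>) J ` P) (R Quot J)"
proof (rule primeidealI)
  interpret J: ideal J R by fact
  interpret P: primeideal P R by fact
  note mem = proj_mem_iff[OF J P.is_ideal JP]
  show "ideal ((+>) J ` P) (R Quot J)"
    using ring_ideal_imp_quot_ideal[OF J P.is_ideal] .
  show "cring (R Quot J)" using J.quotient_is_cring is_cring .
  show "carrier (R Quot J) \<noteq> (+>) J ` P"
  proof
    assume "carrier (R Quot J) = (+>) J ` P"
    moreover have "J +> \<one> \<in> carrier (R Quot J)" by (auto simp: FactRing_simps)
    ultimately have "\<one> \<in> P" using mem by simp
    then show False using P.I_notcarr P.one_imp_carrier by blast
  qed
  fix X Y assume XY: "X \<in> carrier (R Quot J)" "Y \<in> carrier (R Quot J)"
    and m: "X \<otimes>\<^bsub>R Quot J\<^esub> Y \<in> (+>) J ` P"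
  obtain a b where ab: "a \<in> carrier R" "X = J +> a" "b \<in> carrier R" "Y = J +> b"
    using XY by (auto simp: FactRing_simps)
  then have "J +> (a \<otimes> b) \<in> (+>) J ` P" using m J.rcoset_mult_add by (simp add: FactRing_def)
  then have "a \<otimes> b \<in> P" using mem ab by simp
  then show "X \<in> (+>) J ` P \<or> Y \<in> (+>) J ` P" using P.I_prime ab by blast
qed

lemma primeideal_Union_proj:
  assumes J: "ideal J R" and Q: "primeideal Q (R Quot J)"
  shows "primeideal (\<Union>Q) R"
proof -
  have Qi: "ideal Q (R Quot J)" using Q primeideal.axioms(1) by blast
  \<comment> \<open>The union of the cosets in \<open>Q\<close> is the preimage of \<open>Q\<close>
    under the projection, and preimages of primes are prime.\<close>
  have "\<Union>Q = {r \<in> carrier R. J +> r \<in> Q}"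
    using canonical_proj_vimage_in_carrier[OF J, of Q] canonical_proj_vimage_mem_iff[OF J, of Q]
      additive_subgroup.a_subset[OF ideal.axioms(1)[OF Qi]] by blast
  then show ?thesis
    using ring_hom_ring.primeideal_vimage[OF ideal.rcos_ring_hom_ring[OF J] is_cring Q] by simp
qed

text \<open>The correspondence between ideals of \<open>R Quot J\<close> and ideals above
  \<open>J\<close>, given by images and unions, respects primality and strict inclusion in both
  directions, so chains of primes match length by length.\<close>

lemma Kdim_Quot:
  assumes J: "ideal J R"
  shows "Kdim (R Quot J) = Sup {ereal (real n) | n. prime_chain_above R J n}"
proof -
  let ?f = "\<lambda>X. (+>) J ` X"
  have bij: "bij_betw ?f {X. ideal X R \<and> J \<subseteq> X} {X. ideal X (R Quot J)}"
    by (rule quot_ideal_correspondence[OF J])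
  have Un: "?f (\<Union>X) = X \<and> J \<subseteq> \<Union>X" if X: "ideal X (R Quot J)" for X
  proof -
    obtain Y where Y: "ideal Y R" "J \<subseteq> Y" "X = ?f Y"
      using bij X unfolding bij_betw_def by blast
    then have "\<Union>X = Y" using ideal_incl_iff[OF J Y(1)] by simp
    then show ?thesis using Y by simp
  qed
  have "(\<exists>P. (\<forall>i\<le>n. primeideal (P i) (R Quot J)) \<and> (\<forall>i<n. P i \<subset> P (Suc i))) \<longleftrightarrow>
    (\<exists>P. (\<forall>i\<le>n. primeideal (P i) R \<and> J \<subseteq> P i) \<and> (\<forall>i<n. P i \<subset> P (Suc i)))"
    (is "?L \<longleftrightarrow> ?R") for n :: nat
  proof
    assume ?L
    then obtain P where P: "\<And>i. i \<le> n \<Longrightarrow> primeideal (P i) (R Quot J)"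
      and lt: "\<And>i. i < n \<Longrightarrow> P i \<subset> P (Suc i)" by blast
    have id: "ideal (P i) (R Quot J)" if "i \<le> n" for i
      using P[OF that] primeideal.axioms(1) by blast
    show ?R
    proof (intro exI[of _ "\<lambda>i. \<Union>(P i)"] conjI allI impI)
      fix i assume i: "i < n"
      then show "\<Union>(P i) \<subset> \<Union>(P (Suc i))"
        using lt[OF i] Un[OF id, of i] Un[OF id, of "Suc i"] i
        by (metis Suc_leI Union_mono less_imp_le psubset_eq)
    qed (use P Un id primeideal_Union_proj[OF J] in blast)+
  next
    assume ?R
    then obtain P where P: "\<And>i. i \<le> n \<Longrightarrow> primeideal (P i) R" "\<And>i. i \<le> n \<Longrightarrow> J \<subseteq> P i"
      and lt: "\<And>i. i < n \<Longrightarrow> P i \<subset> P (Suc i)" by blast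
    have id: "ideal (P i) R" if "i \<le> n" for i
      using P(1)[OF that] primeideal.axioms(1) by blast
    have inj: "inj_on ?f {X. ideal X R \<and> J \<subseteq> X}" using bij by (simp add: bij_betw_def)
    show ?L
    proof (intro exI[of _ "\<lambda>i. ?f (P i)"] conjI allI impI)
      fix i assume i: "i < n"
      have "?f (P i) \<noteq> ?f (P (Suc i))"
        using inj_onD[OF inj, of "P i" "P (Suc i)"] id P(2) i lt[OF i] by auto
      then show "?f (P i) \<subset> ?f (P (Suc i))" using lt[OF i] by blast
    qed (use P primeideal_image_proj[OF J] in blast)
  qed
  then show ?thesis unfolding Kdim_def prime_chain_above_def by simp
qed

text \<open>The last hypothesis places \<open>J\<close> in the radical of \<open>J'\<close>. A prime
  above \<open>J'\<close> then contains a power of each \<open>r \<in> J\<close>, hence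
  \<open>r\<close> itself, so every chain above \<open>J'\<close> is a chain above
  \<open>J\<close>.\<close>

lemma Kdim_Quot_mono:
  assumes "ideal J R" "ideal J' R" "\<And>r. r \<in> J \<Longrightarrow> \<exists>n::nat. r [^] n \<in> J'"
  shows "Kdim (R Quot J') \<le> Kdim (R Quot J)"
proof -
  have "J \<subseteq> P" if P: "primeideal P R" "J' \<subseteq> P" for P
  proof
    fix r assume r: "r \<in> J"
    then obtain n :: nat where "r [^] n \<in> P" using assms(3) P(2) by blast
    moreover have "r \<in> carrier R" using r ideal.Icarr[OF assms(1)] by simp
    ultimately show "r \<in> P" using primeideal.pow_memD[OF P(1)] by blast
  qed
  then have "prime_chain_above R J n" if "prime_chain_above R J' n" for n
    using that unfolding prime_chain_above_def by meson
  then show ?thesis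
    unfolding Kdim_Quot[OF assms(1)] Kdim_Quot[OF assms(2)]
    by (intro Sup_subset_mono) blast
qed

lemma Kdim_Quot_carrier: "Kdim (R Quot carrier R) = - \<infinity>"
proof -
  have "\<not> (primeideal P R \<and> carrier R \<subseteq> P)" for P
  proof
    assume P: "primeideal P R \<and> carrier R \<subseteq> P"
    then interpret primeideal P R by blast
    show False using P a_subset I_notcarr by blast
  qed
  then have "\<not> prime_chain_above R (carrier R) n" for n
    unfolding prime_chain_above_def by blast
  then show ?thesis unfolding Kdim_Quot[OF oneideal] by (simp add: bot_ereal_def)
qed

text \<open>One prime above \<open>J\<close> is already a chain of length 0. Together with
  \<open>Kdim_Quot_carrier\<close>, the value \<open>- \<infinity>\<close> detects exactly the zero
  quotient.\<close>

lemma Kdim_Quot_proper: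
  assumes "ideal J R" "J \<noteq> carrier R"
  shows "Kdim (R Quot J) \<noteq> - \<infinity>"
proof -
  obtain P where "primeideal P R" "J \<subseteq> P" using exists_primeideal_above[OF assms] by blast
  then have "ereal (real 0) \<le> Kdim (R Quot J)"
    unfolding Kdim_Quot[OF assms(1)] by (intro Sup_upper) (auto simp: prime_chain_above_def zero_ereal_def intro!: exI[of _ 0])
  then show ?thesis by auto
qed

end

section \<open>Super-rings\<close>

text \<open>Both \<open>gen_ideal\<close> and \<open>odd_span\<close> are ranges of finite sums over
  coefficient functions. Splitting off the last summand gives the recursion behind all inductions
  that append a generator.\<close>

lemma (in abelian_monoid) finsum_range_Suc:
  assumes f: "\<And>i x. i \<le> n \<Longrightarrow> x \<in> C \<Longrightarrow> f i x \<in> carrier G"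
  shows "{\<Oplus>i\<in>{..<Suc n}. f i (c i) | c. c \<in> {..<Suc n} \<rightarrow> C} =
    {k \<oplus> f n x | k x. k \<in> {\<Oplus>i\<in>{..<n}. f i (c i) | c. c \<in> {..<n} \<rightarrow> C} \<and> x \<in> C}"
proof -
  have split: "(\<Oplus>i\<in>{..<Suc n}. f i (c i)) = (\<Oplus>i\<in>{..<n}. f i (c i)) \<oplus> f n (c n)"
    if "c \<in> {..<Suc n} \<rightarrow> C" for c
  proof -
    have c: "\<And>i. i \<le> n \<Longrightarrow> c i \<in> C" using that by auto
    have "(\<Oplus>i\<in>{..<Suc n}. f i (c i)) = f n (c n) \<oplus> (\<Oplus>i\<in>{..<n}. f i (c i))"
      unfolding lessThan_Suc by (rule finsum_insert) (use c f in auto)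
    also have "\<dots> = (\<Oplus>i\<in>{..<n}. f i (c i)) \<oplus> f n (c n)"
      by (rule a_comm) (use c f in \<open>auto intro!: finsum_closed\<close>)
    finally show ?thesis .
  qed
  show ?thesis
  proof (intro equalityI subsetI)
    fix x assume "x \<in> {\<Oplus>i\<in>{..<Suc n}. f i (c i) | c. c \<in> {..<Suc n} \<rightarrow> C}"
    then obtain c where c: "c \<in> {..<Suc n} \<rightarrow> C" "x = (\<Oplus>i\<in>{..<Suc n}. f i (c i))" by blast
    then have "c \<in> {..<n} \<rightarrow> C" "c n \<in> C" by auto
    then show "x \<in> {k \<oplus> f n x | k x. k \<in> {\<Oplus>i\<in>{..<n}. f i (c i) | c. c \<in> {..<n} \<rightarrow> C} \<and> x \<in> C}"
      using c split by blast
  next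
    fix x assume "x \<in> {k \<oplus> f n x | k x. k \<in> {\<Oplus>i\<in>{..<n}. f i (c i) | c. c \<in> {..<n} \<rightarrow> C} \<and> x \<in> C}"
    then obtain c a where c: "c \<in> {..<n} \<rightarrow> C" "a \<in> C" "x = (\<Oplus>i\<in>{..<n}. f i (c i)) \<oplus> f n a" by blast
    have c': "c(n := a) \<in> {..<Suc n} \<rightarrow> C" using c by (auto simp: less_Suc_eq)
    have "(\<Oplus>i\<in>{..<n}. f i ((c(n := a)) i)) = (\<Oplus>i\<in>{..<n}. f i (c i))"
      by (rule finsum_cong') (use c f in \<open>auto intro!: f\<close>)
    then have "x = (\<Oplus>i\<in>{..<Suc n}. f i ((c(n := a)) i))" using split[OF c'] c by simp
    then show "x \<in> {\<Oplus>i\<in>{..<Suc n}. f i (c i) | c. c \<in> {..<Suc n} \<rightarrow> C}" using c' by blast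
  qed
qed

section \<open>Products of odd elements and the parity decomposition\<close>

lemma list_prod_Nil [simp]: "list_prod R [] = \<one>\<^bsub>R\<^esub>"
  and list_prod_Cons [simp]: "list_prod R (y # ys) = y \<otimes>\<^bsub>R\<^esub> list_prod R ys"
  by (simp_all add: list_prod_def)

context super_ring
begin

lemma list_prod_closed [simp]: "set ys \<subseteq> carrier R \<Longrightarrow> list_prod R ys \<in> carrier R"
  by (induction ys) auto

lemma list_prod_append:
  "set xs \<subseteq> carrier R \<Longrightarrow> set ys \<subseteq> carrier R \<Longrightarrow>
    list_prod R (xs @ ys) = list_prod R xs \<otimes> list_prod R ys"
  by (induction xs) (auto simp: m_assoc)

sublocale ev: additive_subgroup "ring_ev R" R
  using grading by (simp add: graded_split_def)

sublocale od: additive_subgroup "ring_od R" R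
  using grading by (simp add: graded_split_def)

lemma homogeneous_parts:
  assumes "a \<in> carrier R"
  obtains a0 a1 where "a0 \<in> ring_ev R" "a1 \<in> ring_od R" "a = a0 \<oplus> a1"
  using assms grading unfolding graded_split_def set_add_def' by blast

lemma ev_od_disjoint: "x \<in> ring_ev R \<Longrightarrow> x \<in> ring_od R \<Longrightarrow> x = \<zero>"
  using grading unfolding graded_split_def by blast

text \<open>Write \<open>\<one> = e \<oplus> f\<close> with \<open>e\<close> even and
  \<open>f\<close> odd. Multiplying by \<open>e\<close> shows that the odd element
  \<open>e \<otimes> f\<close> is also even, hence zero; multiplying by \<open>f\<close> and using
  \<open>f \<otimes> f = \<zero>\<close> then gives \<open>f = \<zero>\<close>.\<close>

lemma one_ev: "\<one> \<in> ring_ev R"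
proof -
  obtain e f where ef: "e \<in> ring_ev R" "f \<in> ring_od R" "\<one> = e \<oplus> f"
    using homogeneous_parts[OF one_closed] .
  have c: "e \<in> carrier R" "f \<in> carrier R" using ef by auto
  have "e = e \<otimes> e \<oplus> e \<otimes> f" using ef c by (metis r_distr r_one)
  then have "e \<otimes> f = e \<oplus> \<ominus> (e \<otimes> e)" using c
    by (metis a_comm m_closed r_neg1 a_inv_closed)
  then have "e \<otimes> f \<in> ring_ev R" using ef ev_ev by simp
  then have "e \<otimes> f = \<zero>" using ev_od_disjoint ev_od ef by blast
  moreover have "f \<otimes> e = e \<otimes> f" using ev_central[of e f] ef by simp
  moreover have "f = f \<otimes> e \<oplus> f \<otimes> f" using ef c by (metis r_distr r_one)
  ultimately have "f = \<zero>" using od_square ef by simp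
  then show ?thesis using ef c by simp
qed

lemma even_cring: "cring (even_ring R)"
proof -
  have "subcring (ring_ev R) R"
    by (intro subcringI subringI) (use ev_ev one_ev ev_central ev.a_subset in auto)
  then show ?thesis using subcring_iff ev.a_subset by blast
qed

text \<open>Passing \<open>y\<close> costs a sign on the odd part of \<open>a\<close> only, so
  \<open>b\<close> is \<open>a0 \<oplus> \<ominus> a1\<close>. With \<open>odd_move_right\<close>
  this says that the left and right multiples of an odd element coincide.\<close>

lemma odd_move_left:
  assumes "y \<in> ring_od R" "a \<in> carrier R"
  obtains b where "b \<in> carrier R" "a \<otimes> y = y \<otimes> b"
proof -
  obtain a0 a1 where a: "a0 \<in> ring_ev R" "a1 \<in> ring_od R" "a = a0 \<oplus> a1"
    using homogeneous_parts[OF assms(2)] .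
  have c: "a0 \<in> carrier R" "a1 \<in> carrier R" "y \<in> carrier R" using a assms by auto
  have "a \<otimes> y = y \<otimes> a0 \<oplus> \<ominus> (y \<otimes> a1)"
    using a c assms ev_central[of a0 y] od_anticomm[of a1 y] by (simp add: l_distr)
  also have "\<dots> = y \<otimes> (a0 \<oplus> \<ominus> a1)" using c by (simp add: r_distr r_minus)
  finally show ?thesis by (rule that[rotated]) (use c in simp)
qed

lemma odd_move_right:
  assumes "y \<in> ring_od R" "a \<in> carrier R"
  obtains b where "b \<in> carrier R" "y \<otimes> a = b \<otimes> y"
proof -
  obtain a0 a1 where a: "a0 \<in> ring_ev R" "a1 \<in> ring_od R" "a = a0 \<oplus> a1"
    using homogeneous_parts[OF assms(2)] .
  have c: "a0 \<in> carrier R" "a1 \<in> carrier R" "y \<in> carrier R" using a assms by auto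
  have "y \<otimes> a = a0 \<otimes> y \<oplus> \<ominus> (a1 \<otimes> y)"
    using a c assms ev_central[of a0 y] od_anticomm[of y a1] by (simp add: r_distr)
  also have "\<dots> = (a0 \<oplus> \<ominus> a1) \<otimes> y" using c by (simp add: l_distr l_minus)
  finally show ?thesis by (rule that[rotated]) (use c in simp)
qed

lemma odd_sandwich:
  assumes "y \<in> ring_od R" "a \<in> carrier R"
  shows "y \<otimes> (a \<otimes> y) = \<zero>"
proof -
  obtain b where b: "b \<in> carrier R" "a \<otimes> y = y \<otimes> b" using odd_move_left[OF assms] .
  have "y \<otimes> (y \<otimes> b) = (y \<otimes> y) \<otimes> b" using b assms by (simp add: m_assoc)
  then show ?thesis using b assms od_square by simp
qed

lemma od_carrier [simp]: "set ys \<subseteq> ring_od R \<Longrightarrow> set ys \<subseteq> carrier R"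
  using od.a_subset by blast

lemma list_prod_homogeneous: "set ys \<subseteq> ring_od R \<Longrightarrow> list_prod R ys \<in> ring_ev R \<union> ring_od R"
  by (induction ys) (use one_ev od_ev od_od in auto)

lemma homogeneous_odd_commute:
  assumes "u \<in> ring_ev R \<union> ring_od R" "y \<in> ring_od R"
  shows "u \<otimes> y = y \<otimes> u \<or> u \<otimes> y = \<ominus> (y \<otimes> u)"
  using assms ev_central od_anticomm by blast

text \<open>The head \<open>x\<close> of \<open>xs\<close> is located in \<open>ys\<close> and
  pulled to the front past a homogeneous product, which costs at most a sign. The sign is left
  undetermined because membership in submodules does not depend on it.\<close>

lemma list_prod_perm:
  assumes "mset xs = mset ys" "set xs \<subseteq> ring_od R"
  shows "list_prod R xs = list_prod R ys \<or> list_prod R xs = \<ominus> list_prod R ys"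
  using assms
proof (induction xs arbitrary: ys)
  case (Cons x xs)
  then have "x \<in> set ys" by (metis list.set_intros(1) set_mset_mset)
  then obtain as bs where ys: "ys = as @ x # bs" by (meson split_list)
  then have "mset xs = mset (as @ bs)" using Cons.prems by simp
  have x: "x \<in> ring_od R" using Cons.prems by simp
  have sub: "set ys \<subseteq> ring_od R" using Cons.prems by (metis set_mset_mset)
  then have c: "set as \<subseteq> ring_od R" "set bs \<subseteq> ring_od R" using ys by auto
  note cl = list_prod_closed[OF od_carrier[OF c(1)]] list_prod_closed[OF od_carrier[OF c(2)]] od.a_Hcarr[OF x]
  have IH: "list_prod R xs = list_prod R as \<otimes> list_prod R bs \<or>
      list_prod R xs = \<ominus> (list_prod R as \<otimes> list_prod R bs)"
    using Cons.IH[OF \<open>mset xs = mset (as @ bs)\<close>] Cons.prems c by (simp add: list_prod_append)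
  have ys_eq: "list_prod R ys = (list_prod R as \<otimes> x) \<otimes> list_prod R bs"
    using ys c x cl by (simp add: list_prod_append m_assoc)
  have "list_prod R ys = x \<otimes> (list_prod R as \<otimes> list_prod R bs) \<or>
      list_prod R ys = \<ominus> (x \<otimes> (list_prod R as \<otimes> list_prod R bs))"
    using homogeneous_odd_commute[OF list_prod_homogeneous[OF c(1)] x]
  proof
    assume e: "list_prod R as \<otimes> x = x \<otimes> list_prod R as"
    show ?thesis unfolding ys_eq e using cl by (simp add: m_assoc)
  next
    assume e: "list_prod R as \<otimes> x = \<ominus> (x \<otimes> list_prod R as)"
    show ?thesis unfolding ys_eq e using cl by (simp add: m_assoc l_minus)
  qed
  then show ?case using IH cl by (auto simp: r_minus)
qed simp

text \<open>The occurrence of \<open>y\<close> in the list and the new factor enclose an element of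
  \<open>R\<close>, so \<open>odd_sandwich\<close> applies.\<close>

lemma list_prod_mult_mem:
  assumes "set ys \<subseteq> ring_od R" "y \<in> set ys"
  shows "list_prod R ys \<otimes> y = \<zero>"
  using assms
proof (induction ys)
  case (Cons x ys)
  have c: "x \<in> carrier R" "y \<in> carrier R" "list_prod R ys \<in> carrier R" using Cons.prems by auto
  show ?case
  proof (cases "y = x")
    case True
    then show ?thesis using odd_sandwich Cons.prems c by (simp add: m_assoc)
  next
    case False
    then show ?thesis using Cons c by (simp add: m_assoc)
  qed
qed simp

subsection \<open>Finitely generated superideals and nilpotency\<close>

lemma gen_ideal_Nil [simp]: "gen_ideal R [] = {\<zero>}"
  by (auto simp: gen_ideal_def)

lemma gen_ideal_snoc:
  assumes "set ys \<subseteq> carrier R" "y \<in> carrier R"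
  shows "gen_ideal R (ys @ [y]) = {k \<oplus> a \<otimes> y | k a. k \<in> gen_ideal R ys \<and> a \<in> carrier R}"
proof -
  let ?n = "length ys"
  have "(ys @ [y]) ! i \<in> carrier R" if "i \<le> ?n" for i
    using that assms by (auto simp: nth_append)
  then have "gen_ideal R (ys @ [y]) =
    {k \<oplus> x \<otimes> (ys @ [y]) ! ?n | k x. k \<in> {\<Oplus>i\<in>{..<?n}. c i \<otimes> (ys @ [y]) ! i | c.
       c \<in> {..<?n} \<rightarrow> carrier R} \<and> x \<in> carrier R}"
    unfolding gen_ideal_def length_append_singleton by (intro finsum_range_Suc) auto
  moreover have "{\<Oplus>i\<in>{..<?n}. c i \<otimes> (ys @ [y]) ! i | c. c \<in> {..<?n} \<rightarrow> carrier R} = gen_ideal R ys"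
  proof -
    have "(\<Oplus>i\<in>{..<?n}. c i \<otimes> (ys @ [y]) ! i) = (\<Oplus>i\<in>{..<?n}. c i \<otimes> ys ! i)"
      if "c \<in> {..<?n} \<rightarrow> carrier R" for c
      by (rule finsum_cong') (use that assms in \<open>auto simp: nth_append Pi_iff subset_iff\<close>)
    then show ?thesis unfolding gen_ideal_def
      by (intro Collect_cong arg_cong[where f = Ex] ext) auto
  qed
  ultimately show ?thesis by simp
qed

lemma superidealI:
  assumes J: "ideal J R"
    and dec: "\<And>x. x \<in> J \<Longrightarrow> \<exists>x0 x1. x0 \<in> J \<inter> ring_ev R \<and> x1 \<in> J \<inter> ring_od R \<and> x = x0 \<oplus> x1"
  shows "superideal R J"
proof -
  interpret J: ideal J R by fact
  have "additive_subgroup (J \<inter> H) R" if "additive_subgroup H R" for H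
    using that J.additive_subgroup_axioms add.subgroups_Inter_pair
    unfolding additive_subgroup_def by blast
  moreover have "J = (J \<inter> ring_ev R) <+> (J \<inter> ring_od R)"
    using dec J.a_closed unfolding set_add_def' by blast
  ultimately show ?thesis
    using J ev.additive_subgroup_axioms od.additive_subgroup_axioms ev_od_disjoint
      J.zero_closed ev.zero_closed od.zero_closed
    unfolding superideal_def graded_split_def by blast
qed

lemma superideal_parts:
  assumes "superideal R J" "x \<in> J"
  shows "\<exists>x0 x1. x0 \<in> J \<inter> ring_ev R \<and> x1 \<in> J \<inter> ring_od R \<and> x = x0 \<oplus> x1"
  using assms unfolding superideal_def graded_split_def set_add_def' by blast

text \<open>Generators are appended one at a time. As \<open>y\<close> is odd, multiplication by it
  swaps parities, and it can be moved past any scalar, so the left multiples of \<open>y\<close>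
  added to a superideal again form a superideal.\<close>

lemma superideal_gen_ideal:
  assumes "set ys \<subseteq> ring_od R"
  shows "superideal R (gen_ideal R ys)"
  using assms
proof (induction ys rule: rev_induct)
  case Nil
  show ?case by (rule superidealI) (auto simp: zeroideal)
next
  case (snoc y ys)
  let ?J = "gen_ideal R ys" and ?K = "gen_ideal R (ys @ [y])"
  have y: "y \<in> ring_od R" "y \<in> carrier R" and ys: "set ys \<subseteq> ring_od R" using snoc.prems by auto
  have J: "superideal R ?J" using snoc by simp
  then interpret J: ideal ?J R by (simp add: superideal_def)
  have K: "?K = {k \<oplus> a \<otimes> y | k a. k \<in> ?J \<and> a \<in> carrier R}"
    using gen_ideal_snoc ys y by simp
  have "ideal ?K R"
  proof (rule idealI)
    show "ring R" by (rule ring_axioms)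
    show "subgroup ?K (add_monoid R)"
    proof (rule add.subgroupI)
      show "?K \<subseteq> carrier R" unfolding K using y by auto
      show "?K \<noteq> {}" unfolding K using J.zero_closed zero_closed by blast
    next
      fix x assume "x \<in> ?K"
      then obtain k a where x: "x = k \<oplus> a \<otimes> y" "k \<in> ?J" "a \<in> carrier R" unfolding K by blast
      then have "\<ominus> x = \<ominus> k \<oplus> (\<ominus> a) \<otimes> y" using y by (simp add: minus_add l_minus)
      then show "\<ominus> x \<in> ?K" unfolding K using x J.a_inv_closed a_inv_closed by blast
    next
      fix x x' assume "x \<in> ?K" "x' \<in> ?K"
      then obtain k a k' a' where x: "x = k \<oplus> a \<otimes> y" "k \<in> ?J" "a \<in> carrier R"
        "x' = k' \<oplus> a' \<otimes> y" "k' \<in> ?J" "a' \<in> carrier R" unfolding K by blast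
      then have "x \<oplus> x' = (k \<oplus> k') \<oplus> (a \<oplus> a') \<otimes> y" using y by (simp add: l_distr a_ac)
      then show "x \<oplus> x' \<in> ?K" unfolding K using x J.a_closed a_closed by blast
    qed
  next
    fix x r assume "x \<in> ?K" and r: "r \<in> carrier R"
    then obtain k a where x: "x = k \<oplus> a \<otimes> y" "k \<in> ?J" "a \<in> carrier R" unfolding K by blast
    then have "r \<otimes> x = r \<otimes> k \<oplus> (r \<otimes> a) \<otimes> y" using y r by (simp add: r_distr m_assoc)
    then show "r \<otimes> x \<in> ?K" unfolding K using x r J.I_l_closed m_closed by blast
    \<comment> \<open>The generating set is one of left multiples; closure under right
      multiplication comes from rewriting \<open>y \<otimes> r\<close> as a left multiple of
      \<open>y\<close>.\<close>
    obtain b where b: "b \<in> carrier R" "y \<otimes> r = b \<otimes> y" using odd_move_right[OF y(1) r] .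
    have "x \<otimes> r = k \<otimes> r \<oplus> (a \<otimes> b) \<otimes> y" using x y r b by (simp add: l_distr m_assoc)
    then show "x \<otimes> r \<in> ?K" unfolding K using x r b J.I_r_closed m_closed by blast
  qed
  then show ?case
  proof (rule superidealI)
    fix x assume "x \<in> ?K"
    then obtain k a where x: "x = k \<oplus> a \<otimes> y" "k \<in> ?J" "a \<in> carrier R" unfolding K by blast
    obtain k0 k1 where k: "k0 \<in> ?J" "k0 \<in> ring_ev R" "k1 \<in> ?J" "k1 \<in> ring_od R" "k = k0 \<oplus> k1"
      using superideal_parts[OF J x(2)] by blast
    obtain a0 a1 where a: "a0 \<in> ring_ev R" "a1 \<in> ring_od R" "a = a0 \<oplus> a1"
      using homogeneous_parts[OF x(3)] .
    have c: "a0 \<in> carrier R" "a1 \<in> carrier R" "k0 \<in> carrier R" "k1 \<in> carrier R" using k a by auto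
    \<comment> \<open>The odd coefficient \<open>a1\<close> contributes to the even part of
      \<open>x\<close>, and the even coefficient \<open>a0\<close> to the odd part.\<close>
    have "x = (k0 \<oplus> a1 \<otimes> y) \<oplus> (k1 \<oplus> a0 \<otimes> y)" using x k a y c by (simp add: l_distr a_ac)
    moreover have "k0 \<oplus> a1 \<otimes> y \<in> ?K" "k1 \<oplus> a0 \<otimes> y \<in> ?K"
      unfolding K using k c by blast+
    moreover have "k0 \<oplus> a1 \<otimes> y \<in> ring_ev R" "k1 \<oplus> a0 \<otimes> y \<in> ring_od R"
      using k a y ev_od od_od by simp_all
    ultimately show "\<exists>x0 x1. x0 \<in> ?K \<inter> ring_ev R \<and> x1 \<in> ?K \<inter> ring_od R \<and> x = x0 \<oplus> x1" by blast
  qed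
qed

lemma ideal_gen_ideal: "set ys \<subseteq> ring_od R \<Longrightarrow> ideal (gen_ideal R ys) R"
  using superideal_gen_ideal by (simp add: superideal_def)

lemma gen_ideal_incl:
  assumes "set ys \<subseteq> ring_od R"
  shows "set ys \<subseteq> gen_ideal R ys"
  using assms
proof (induction ys rule: rev_induct)
  case (snoc y ys)
  have y: "y \<in> carrier R" and ys: "set ys \<subseteq> ring_od R" using snoc.prems by auto
  interpret J: ideal "gen_ideal R ys" R using ideal_gen_ideal[OF ys] .
  have K: "gen_ideal R (ys @ [y]) = {k \<oplus> a \<otimes> y | k a. k \<in> gen_ideal R ys \<and> a \<in> carrier R}"
    using gen_ideal_snoc ys y by simp
  have "\<zero> \<oplus> \<one> \<otimes> y \<in> gen_ideal R (ys @ [y])" unfolding K using J.zero_closed by blast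
  moreover have "k \<oplus> \<zero> \<otimes> y \<in> gen_ideal R (ys @ [y])" if "k \<in> gen_ideal R ys" for k
    unfolding K using that by blast
  ultimately have "y \<in> gen_ideal R (ys @ [y])" "gen_ideal R ys \<subseteq> gen_ideal R (ys @ [y])"
    using y J.Icarr by auto
  then show ?case using snoc.IH[OF ys] by auto
qed simp

text \<open>Otherwise every finite list of odd elements leaves out some odd \<open>z ys\<close>.
  Appending it again and again yields a chain of superideals that never becomes stationary.\<close>

lemma noetherian_odd_gen:
  assumes "super_noetherian R"
  shows "\<exists>ys. set ys \<subseteq> ring_od R \<and> ring_od R \<subseteq> gen_ideal R ys"
proof (rule ccontr)
  assume "\<not> ?thesis"
  then have "\<forall>ys. \<exists>z. set ys \<subseteq> ring_od R \<longrightarrow> z \<in> ring_od R \<and> z \<notin> gen_ideal R ys" by blast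
  then obtain z where z: "\<And>ys. set ys \<subseteq> ring_od R \<Longrightarrow> z ys \<in> ring_od R \<and> z ys \<notin> gen_ideal R ys"
    by metis
  define L where "L n = ((\<lambda>ys. ys @ [z ys]) ^^ n) []" for n
  have LSuc: "L (Suc n) = L n @ [z (L n)]" for n by (simp add: L_def)
  have L: "set (L n) \<subseteq> ring_od R" for n
    by (induction n) (use z in \<open>auto simp: LSuc\<close>, simp add: L_def)
  have "gen_ideal R (L n) \<subseteq> gen_ideal R (L (Suc n))" for n
  proof
    fix k assume k: "k \<in> gen_ideal R (L n)"
    have zc: "z (L n) \<in> carrier R" using z[OF L[of n]] by simp
    have "k \<in> carrier R" using ideal.Icarr[OF ideal_gen_ideal[OF L] k] .
    then have "k = k \<oplus> \<zero> \<otimes> z (L n)" using zc by simp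
    then show "k \<in> gen_ideal R (L (Suc n))"
      unfolding LSuc gen_ideal_snoc[OF od_carrier[OF L] zc] using k by blast
  qed
  then have "\<exists>N. \<forall>n\<ge>N. gen_ideal R (L n) = gen_ideal R (L N)"
    using superideal_gen_ideal[OF L]
    by (intro assms[unfolded super_noetherian_def, THEN spec, THEN mp]) simp
  then obtain N where N: "\<forall>n\<ge>N. gen_ideal R (L n) = gen_ideal R (L N)" ..
  have "gen_ideal R (L (Suc N)) = gen_ideal R (L N)" by (rule N[rule_format]) simp
  moreover have "z (L N) \<in> gen_ideal R (L (Suc N))"
    using gen_ideal_incl[OF L[of "Suc N"]] by (simp add: LSuc)
  ultimately show False using z[OF L[of N]] by simp
qed

text \<open>The square of \<open>J + R y\<close> lies in the ideal \<open>J\<close>, so doubling the length of the products removes one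
  generator.\<close>

lemma long_odd_products_descend:
  assumes "set ys \<subseteq> ring_od R"
    and "\<And>us. set us \<subseteq> ring_od R \<Longrightarrow> length us = n \<Longrightarrow> list_prod R us \<in> gen_ideal R ys"
  shows "\<exists>N. \<forall>us. set us \<subseteq> ring_od R \<longrightarrow> length us = N \<longrightarrow> list_prod R us = \<zero>"
  using assms
proof (induction ys arbitrary: n rule: rev_induct)
  case Nil
  have "list_prod R us = \<zero>" if "set us \<subseteq> ring_od R" "length us = n" for us
    using Nil(2)[OF that] by simp
  then show ?case by blast
next
  case (snoc y ys)
  have y: "y \<in> ring_od R" "y \<in> carrier R" and ys: "set ys \<subseteq> ring_od R" using snoc.prems by auto
  interpret J: ideal "gen_ideal R ys" R using ideal_gen_ideal[OF ys] .
  have K: "gen_ideal R (ys @ [y]) = {k \<oplus> a \<otimes> y | k a. k \<in> gen_ideal R ys \<and> a \<in> carrier R}"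
    using gen_ideal_snoc ys y by simp
  have mult: "u \<otimes> v \<in> gen_ideal R ys"
    if uv: "u \<in> gen_ideal R (ys @ [y])" "v \<in> gen_ideal R (ys @ [y])" for u v
  proof -
    obtain k a l b where u: "k \<in> gen_ideal R ys" "a \<in> carrier R" "u = k \<oplus> a \<otimes> y"
      and v: "l \<in> gen_ideal R ys" "b \<in> carrier R" "v = l \<oplus> b \<otimes> y"
      using uv unfolding K by blast
    have kl: "k \<in> carrier R" "l \<in> carrier R" using u v by auto
    \<comment> \<open>In the expanded product only the term with two factors \<open>y\<close> is not
      visibly in the smaller ideal, and that term vanishes by \<open>odd_sandwich\<close>.\<close>
    have "u \<otimes> v = (k \<otimes> v) \<oplus> ((a \<otimes> y) \<otimes> l \<oplus> a \<otimes> (y \<otimes> (b \<otimes> y)))"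
      using u v kl y by (simp add: l_distr r_distr m_assoc a_ac)
    also have "\<dots> = (k \<otimes> v) \<oplus> (a \<otimes> y) \<otimes> l"
      using odd_sandwich[OF y(1) v(2)] u v y kl by simp
    also have "\<dots> \<in> gen_ideal R ys"
      using u v y kl J.I_l_closed J.I_r_closed by auto
    finally show ?thesis .
  qed
  show ?case
  proof (rule snoc.IH[OF ys])
    fix us :: "'a list" assume us: "set us \<subseteq> ring_od R" "length us = n + n"
    have tk: "set (take n us) \<subseteq> ring_od R" "set (drop n us) \<subseteq> ring_od R"
      using us by (meson set_take_subset set_drop_subset subset_trans)+
    have "list_prod R us = list_prod R (take n us) \<otimes> list_prod R (drop n us)"
      using list_prod_append[OF od_carrier[OF tk(1)] od_carrier[OF tk(2)]] by simp
    also have "\<dots> \<in> gen_ideal R ys"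
      using mult snoc.prems(2)[OF tk(1)] snoc.prems(2)[OF tk(2)] us by simp
    finally show "list_prod R us \<in> gen_ideal R ys" .
  qed
qed

text \<open>Products of length 1 lie in the ideal generated by \<open>ys\<close>, and descending
  through the generators reaches the zero ideal. A longer product has a vanishing initial segment.
  This bounds the length of systems of odd parameters.\<close>

lemma noetherian_odd_nilpotent:
  assumes "super_noetherian R"
  shows "\<exists>N. \<forall>us. set us \<subseteq> ring_od R \<longrightarrow> N \<le> length us \<longrightarrow> list_prod R us = \<zero>"
proof -
  obtain ys where ys: "set ys \<subseteq> ring_od R" "ring_od R \<subseteq> gen_ideal R ys"
    using noetherian_odd_gen[OF assms] by (elim exE conjE)
  have "list_prod R us \<in> gen_ideal R ys" if "set us \<subseteq> ring_od R" "length us = 1" for us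
    using that ys by (cases us) auto
  then obtain N where N: "\<And>us. set us \<subseteq> ring_od R \<Longrightarrow> length us = N \<Longrightarrow> list_prod R us = \<zero>"
    using long_odd_products_descend[OF ys(1)] by blast
  have "list_prod R us = \<zero>" if us: "set us \<subseteq> ring_od R" "N \<le> length us" for us
  proof -
    have tk: "set (take N us) \<subseteq> ring_od R" "set (drop N us) \<subseteq> ring_od R"
      using us by (meson set_take_subset set_drop_subset subset_trans)+
    have "list_prod R us = list_prod R (take N us) \<otimes> list_prod R (drop N us)"
      using list_prod_append[OF od_carrier[OF tk(1)] od_carrier[OF tk(2)]] by simp
    then show ?thesis using N[OF tk(1)] us tk by simp
  qed
  then show ?thesis by blast
qed

end

section \<open>Supermodules\<close>

locale supermod = super_module R M
  for R :: "('a, 'm) superring_scheme" (structure) and M :: "('a, 'b) supermodule" (structure)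
begin

lemma smult_r_zero [simp]: "a \<in> carrier R \<Longrightarrow> a \<odot>\<^bsub>M\<^esub> \<zero>\<^bsub>M\<^esub> = \<zero>\<^bsub>M\<^esub>"
  using smult_r_distr[of a "\<zero>\<^bsub>M\<^esub>" "\<zero>\<^bsub>M\<^esub>"] smult_closed[of a "\<zero>\<^bsub>M\<^esub>"]
  by (simp add: M.add.l_cancel_one)

lemma smult_l_zero [simp]: "x \<in> carrier M \<Longrightarrow> \<zero> \<odot>\<^bsub>M\<^esub> x = \<zero>\<^bsub>M\<^esub>"
  using smult_l_distr[of \<zero> \<zero> x] smult_closed[of \<zero> x]
  by (simp add: M.add.l_cancel_one)

lemma smult_l_minus: "a \<in> carrier R \<Longrightarrow> x \<in> carrier M \<Longrightarrow> (\<ominus> a) \<odot>\<^bsub>M\<^esub> x = \<ominus>\<^bsub>M\<^esub> (a \<odot>\<^bsub>M\<^esub> x)"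
  using smult_l_distr[of "\<ominus> a" a x] smult_closed
  by (intro M.minus_equality[symmetric]) (simp_all add: R.l_neg)

lemma smult_r_minus: "a \<in> carrier R \<Longrightarrow> x \<in> carrier M \<Longrightarrow> a \<odot>\<^bsub>M\<^esub> (\<ominus>\<^bsub>M\<^esub> x) = \<ominus>\<^bsub>M\<^esub> (a \<odot>\<^bsub>M\<^esub> x)"
  using smult_r_distr[of a "\<ominus>\<^bsub>M\<^esub> x" x] smult_closed
  by (intro M.minus_equality[symmetric]) (simp_all add: M.l_neg)

declare smult_closed [simp]

subsection \<open>Submodules and colon ideals\<close>

definition stable :: "'b set \<Rightarrow> bool" where
  "stable K \<longleftrightarrow> additive_subgroup K M \<and> (\<forall>a\<in>carrier R. \<forall>x\<in>K. a \<odot>\<^bsub>M\<^esub> x \<in> K)"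

lemma stableD:
  assumes "stable K"
  shows "K \<subseteq> carrier M" "\<zero>\<^bsub>M\<^esub> \<in> K" "\<And>x y. x \<in> K \<Longrightarrow> y \<in> K \<Longrightarrow> x \<oplus>\<^bsub>M\<^esub> y \<in> K"
    "\<And>x. x \<in> K \<Longrightarrow> \<ominus>\<^bsub>M\<^esub> x \<in> K" "\<And>a x. a \<in> carrier R \<Longrightarrow> x \<in> K \<Longrightarrow> a \<odot>\<^bsub>M\<^esub> x \<in> K"
proof -
  interpret K: additive_subgroup K M using assms by (simp add: stable_def)
  show "K \<subseteq> carrier M" "\<zero>\<^bsub>M\<^esub> \<in> K" "\<And>x y. x \<in> K \<Longrightarrow> y \<in> K \<Longrightarrow> x \<oplus>\<^bsub>M\<^esub> y \<in> K"
    "\<And>x. x \<in> K \<Longrightarrow> \<ominus>\<^bsub>M\<^esub> x \<in> K"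
    using K.a_subset K.a_inv_closed by auto
  show "\<And>a x. a \<in> carrier R \<Longrightarrow> x \<in> K \<Longrightarrow> a \<odot>\<^bsub>M\<^esub> x \<in> K"
    using assms by (simp add: stable_def)
qed

lemma stableI:
  assumes "K \<subseteq> carrier M" "\<zero>\<^bsub>M\<^esub> \<in> K" "\<And>x y. x \<in> K \<Longrightarrow> y \<in> K \<Longrightarrow> x \<oplus>\<^bsub>M\<^esub> y \<in> K"
    "\<And>a x. a \<in> carrier R \<Longrightarrow> x \<in> K \<Longrightarrow> a \<odot>\<^bsub>M\<^esub> x \<in> K"
  shows "stable K"
proof -
  have "\<ominus>\<^bsub>M\<^esub> x \<in> K" if "x \<in> K" for x
  proof -
    have "\<ominus>\<^bsub>M\<^esub> x = (\<ominus> \<one>) \<odot>\<^bsub>M\<^esub> x" using that assms(1) smult_one smult_l_minus by auto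
    then show ?thesis using assms(4)[of "\<ominus> \<one>" x] that by simp
  qed
  then have "subgroup K (add_monoid M)"
    using assms by (intro M.add.subgroupI) auto
  then show ?thesis using assms(4) by (simp add: stable_def additive_subgroup_def)
qed

lemma stable_zero [simp]: "stable {\<zero>\<^bsub>M\<^esub>}"
  by (rule stableI) auto

text \<open>A pair \<open>(K, L)\<close> stands for the image of \<open>L\<close> in \<open>M/K\<close>; this covers \<open>IM\<close>, \<open>M/IM\<close> and
  \<open>y\<^sub>1 \<cdots> y\<^sub>t M\<close> at once.\<close>

definition colon :: "'b set \<Rightarrow> 'b set \<Rightarrow> 'a set" where
  "colon K L = {r \<in> ring_ev R. \<forall>x\<in>L. r \<odot>\<^bsub>M\<^esub> x \<in> K}"

lemma colon_ideal:
  assumes K: "stable K" and L: "L \<subseteq> carrier M"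
  shows "ideal (colon K L) (even_ring R)"
proof -
  interpret E: cring "even_ring R" by (rule even_cring)
  note K = stableD[OF K]
  have LC: "\<And>x. x \<in> L \<Longrightarrow> x \<in> carrier M" using L by blast
  \<comment> \<open>The additive inverse is defined relative to the carrier, so the inverses in
    \<open>even_ring R\<close> and in \<open>R\<close> must be identified.\<close>
  have neg: "\<ominus>\<^bsub>even_ring R\<^esub> a = \<ominus> a" if "a \<in> ring_ev R" for a
    by (rule E.minus_equality) (use that in \<open>auto simp: R.l_neg\<close>)
  show ?thesis
  proof (rule idealI)
    show "ring (even_ring R)" by (rule E.ring_axioms)
    show "subgroup (colon K L) (add_monoid (even_ring R))"
    proof (rule E.add.subgroupI)
      show "colon K L \<subseteq> carrier (even_ring R)" by (auto simp: colon_def)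
      show "colon K L \<noteq> {}" using K(2) LC by (auto simp: colon_def intro!: exI[of _ \<zero>])
    next
      fix a assume a: "a \<in> colon K L"
      then show "\<ominus>\<^bsub>even_ring R\<^esub> a \<in> colon K L"
        using K(4) LC neg by (auto simp: colon_def smult_l_minus)
    next
      fix a b assume "a \<in> colon K L" "b \<in> colon K L"
      then show "a \<oplus>\<^bsub>even_ring R\<^esub> b \<in> colon K L"
        using K(3) LC by (auto simp: colon_def smult_l_distr)
    qed
  next
    fix a r assume a: "a \<in> colon K L" and "r \<in> carrier (even_ring R)"
    then have r: "r \<in> ring_ev R" by simp
    have "r \<otimes> a \<in> colon K L"
      using a r K(5) LC ev_ev by (auto simp: colon_def smult_assoc)
    moreover have "a \<otimes> r = r \<otimes> a" using a r ev_central by (auto simp: colon_def)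
    ultimately show "r \<otimes>\<^bsub>even_ring R\<^esub> a \<in> colon K L" "a \<otimes>\<^bsub>even_ring R\<^esub> r \<in> colon K L" by simp_all
  qed
qed

definition cdim :: "'b set \<Rightarrow> 'b set \<Rightarrow> ereal" where
  "cdim K L = Kdim (even_ring R Quot colon K L)"

text \<open>\<open>Kdim_Quot_mono\<close> in terms of the action: an even element sending
  \<open>L\<close> into \<open>K\<close> needs only a power sending \<open>L'\<close> into
  \<open>K'\<close>.\<close>

lemma cdim_mono_radical:
  assumes "stable K" "L \<subseteq> carrier M" "stable K'" "L' \<subseteq> carrier M"
    and rad: "\<And>r. r \<in> ring_ev R \<Longrightarrow> (\<And>x. x \<in> L \<Longrightarrow> r \<odot>\<^bsub>M\<^esub> x \<in> K) \<Longrightarrow>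
      \<exists>n::nat. \<forall>x\<in>L'. (r [^] n) \<odot>\<^bsub>M\<^esub> x \<in> K'"
  shows "cdim K' L' \<le> cdim K L"
proof -
  interpret E: cring "even_ring R" by (rule even_cring)
  show ?thesis
    unfolding cdim_def
  proof (rule E.Kdim_Quot_mono[OF colon_ideal colon_ideal])
    fix r assume r: "r \<in> colon K L"
    then obtain n :: nat where n: "\<forall>x\<in>L'. (r [^] n) \<odot>\<^bsub>M\<^esub> x \<in> K'"
      using rad[of r] by (auto simp: colon_def)
    have eq: "r [^]\<^bsub>even_ring R\<^esub> n = r [^] n" by (simp add: nat_pow_def)
    have "r [^]\<^bsub>even_ring R\<^esub> n \<in> carrier (even_ring R)"
      using r by (intro E.nat_pow_closed) (simp add: colon_def)
    then have "r [^]\<^bsub>even_ring R\<^esub> n \<in> colon K' L'" using n by (simp add: colon_def eq)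
    then show "\<exists>n::nat. r [^]\<^bsub>even_ring R\<^esub> n \<in> colon K' L'" ..
  qed (use assms in auto)
qed

lemma cdim_mono:
  assumes "stable K" "L \<subseteq> carrier M" "stable K'" "L' \<subseteq> carrier M"
    and sub: "\<And>r x. r \<in> ring_ev R \<Longrightarrow> (\<And>x. x \<in> L \<Longrightarrow> r \<odot>\<^bsub>M\<^esub> x \<in> K) \<Longrightarrow> x \<in> L' \<Longrightarrow> r \<odot>\<^bsub>M\<^esub> x \<in> K'"
  shows "cdim K' L' \<le> cdim K L"
  by (rule cdim_mono_radical[OF assms(1-4)]) (use sub in \<open>auto intro!: exI[of _ "Suc 0"]\<close>)

lemma cdim_subset: "stable K \<Longrightarrow> L' \<subseteq> L \<Longrightarrow> L \<subseteq> carrier M \<Longrightarrow> cdim K L' \<le> cdim K L"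
  by (rule cdim_mono) auto

lemma cdim_eq_minus_infinity:
  assumes "stable K" "L \<subseteq> K"
  shows "cdim K L = - \<infinity>"
proof -
  interpret E: cring "even_ring R" by (rule even_cring)
  have "colon K L = carrier (even_ring R)"
    using assms stableD[OF assms(1)] by (auto simp: colon_def)
  then show ?thesis using E.Kdim_Quot_carrier by (simp add: cdim_def)
qed

lemma cdim_proper:
  assumes "stable K" "L \<subseteq> carrier M" "\<not> L \<subseteq> K"
  shows "cdim K L \<noteq> - \<infinity>"
proof -
  interpret E: cring "even_ring R" by (rule even_cring)
  obtain x where "x \<in> L" "x \<notin> K" using assms(3) by blast
  then have "\<one> \<notin> colon K L" using smult_one[of x] assms(2) by (force simp: colon_def)
  then have "colon K L \<noteq> carrier (even_ring R)" using one_ev by auto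
  then show ?thesis using E.Kdim_Quot_proper[OF colon_ideal] assms by (simp add: cdim_def)
qed

subsection \<open>Odd parameters\<close>

definition prod_image :: "'a list \<Rightarrow> 'b set \<Rightarrow> 'b set" where
  "prod_image w L = (\<lambda>x. list_prod R w \<odot>\<^bsub>M\<^esub> x) ` L"

text \<open>With \<open>max_params\<close>, the counterpart of \<open>odd_params\<close> and
  \<open>sdim1\<close> for the image of \<open>L\<close> in \<open>M/K\<close>. The identification
  is made in \<open>sdim1_eq\<close>, \<open>sdim1_sub\<close> and
  \<open>sdim1_quot\<close>.\<close>

definition params :: "'b set \<Rightarrow> 'b set \<Rightarrow> 'a list \<Rightarrow> bool" where
  "params K L w \<longleftrightarrow> w \<noteq> [] \<and> set w \<subseteq> ring_od R \<and> cdim K (prod_image w L) = cdim K L"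

definition max_params :: "'b set \<Rightarrow> 'b set \<Rightarrow> nat" where
  "max_params K L = Max (insert 0 {length w | w. params K L w})"

lemma prod_image_closed: "set w \<subseteq> ring_od R \<Longrightarrow> L \<subseteq> carrier M \<Longrightarrow> prod_image w L \<subseteq> carrier M"
  by (auto simp: prod_image_def subset_iff)

lemma prod_image_append:
  assumes "set v \<subseteq> ring_od R" "set w \<subseteq> ring_od R" "L \<subseteq> carrier M"
  shows "prod_image (v @ w) L = prod_image v (prod_image w L)"
proof -
  have "list_prod R (v @ w) \<odot>\<^bsub>M\<^esub> x = list_prod R v \<odot>\<^bsub>M\<^esub> (list_prod R w \<odot>\<^bsub>M\<^esub> x)" if "x \<in> L" for x
    using that assms by (simp add: list_prod_append smult_assoc subset_iff)
  then show ?thesis by (auto simp: prod_image_def image_image)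
qed

lemma prod_image_mono: "L \<subseteq> L' \<Longrightarrow> prod_image w L \<subseteq> prod_image w L'"
  by (auto simp: prod_image_def)

lemma smult_ev_commute:
  assumes "r \<in> ring_ev R" "set w \<subseteq> ring_od R" "x \<in> carrier M"
  shows "r \<odot>\<^bsub>M\<^esub> (list_prod R w \<odot>\<^bsub>M\<^esub> x) = list_prod R w \<odot>\<^bsub>M\<^esub> (r \<odot>\<^bsub>M\<^esub> x)"
proof -
  have "r \<otimes> list_prod R w = list_prod R w \<otimes> r"
    using ev_central[OF assms(1) list_prod_homogeneous[OF assms(2)]] .
  then show ?thesis using assms smult_assoc[of r "list_prod R w" x] smult_assoc[of "list_prod R w" r x] by simp
qed

text \<open>By \<open>list_prod_perm\<close> the two products agree up to sign, and the subgroup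
  \<open>K\<close> absorbs the sign.\<close>

lemma colon_prod_image_perm:
  assumes K: "stable K" and L: "L \<subseteq> carrier M" and v: "set v \<subseteq> ring_od R" and vw: "mset v = mset w"
  shows "colon K (prod_image v L) = colon K (prod_image w L)"
proof -
  have w: "set w \<subseteq> ring_od R" using v vw by (metis set_mset_mset)
  have "r \<odot>\<^bsub>M\<^esub> (list_prod R v \<odot>\<^bsub>M\<^esub> x) \<in> K \<longleftrightarrow> r \<odot>\<^bsub>M\<^esub> (list_prod R w \<odot>\<^bsub>M\<^esub> x) \<in> K"
    if r: "r \<in> ring_ev R" and x: "x \<in> L" for r x
    using list_prod_perm[OF vw v]
  proof
    assume "list_prod R v = \<ominus> list_prod R w"
    then have e: "r \<odot>\<^bsub>M\<^esub> (list_prod R v \<odot>\<^bsub>M\<^esub> x) = \<ominus>\<^bsub>M\<^esub> (r \<odot>\<^bsub>M\<^esub> (list_prod R w \<odot>\<^bsub>M\<^esub> x))"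
      using w x r L by (simp add: smult_l_minus smult_r_minus subset_iff)
    have "r \<odot>\<^bsub>M\<^esub> (list_prod R w \<odot>\<^bsub>M\<^esub> x) \<in> carrier M" using w x r L by (simp add: subset_iff)
    then show ?thesis unfolding e using stableD(4)[OF K] M.minus_minus by metis
  qed simp
  then show ?thesis by (auto simp: colon_def prod_image_def)
qed

lemma cdim_prod_image_perm:
  "stable K \<Longrightarrow> L \<subseteq> carrier M \<Longrightarrow> set v \<subseteq> ring_od R \<Longrightarrow> mset v = mset w \<Longrightarrow>
    cdim K (prod_image v L) = cdim K (prod_image w L)"
  using colon_prod_image_perm by (simp add: cdim_def)

text \<open>Even scalars commute with \<open>list_prod R w\<close>, so whatever sends
  \<open>L\<close> into \<open>K\<close> also sends the image of \<open>L\<close> under the product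
  into \<open>K\<close>. Hence systems of parameters only require the opposite inequality, as
  recorded in \<open>paramsI\<close>.\<close>

lemma cdim_prod_image_le:
  assumes "stable K" "L \<subseteq> carrier M" "set w \<subseteq> ring_od R"
  shows "cdim K (prod_image w L) \<le> cdim K L"
proof (rule cdim_mono)
  fix r x assume r: "r \<in> ring_ev R" "\<And>x. x \<in> L \<Longrightarrow> r \<odot>\<^bsub>M\<^esub> x \<in> K" and x: "x \<in> prod_image w L"
  then obtain z where z: "z \<in> L" "x = list_prod R w \<odot>\<^bsub>M\<^esub> z" by (auto simp: prod_image_def)
  have "r \<odot>\<^bsub>M\<^esub> x = list_prod R w \<odot>\<^bsub>M\<^esub> (r \<odot>\<^bsub>M\<^esub> z)"
    using smult_ev_commute[OF r(1) assms(3)] z assms(2) by auto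
  then show "r \<odot>\<^bsub>M\<^esub> x \<in> K" using stableD(5)[OF assms(1)] r(2)[OF z(1)] assms(3) by simp
qed (use assms prod_image_closed in auto)

lemma paramsI:
  assumes "stable K" "L \<subseteq> carrier M" "set w \<subseteq> ring_od R" "w \<noteq> []"
    and "cdim K L \<le> cdim K (prod_image w L)"
  shows "params K L w"
  using assms cdim_prod_image_le[OF assms(1-3)] by (simp add: params_def)

text \<open>Beyond the nilpotency bound the product is zero and the dimension drops to
  \<open>- \<infinity>\<close>. Finiteness is what gives the \<open>Max\<close> in
  \<open>max_params\<close> its intended meaning.\<close>

lemma finite_params_lengths:
  assumes "super_noetherian R" "stable K" "L \<subseteq> carrier M" "cdim K L \<noteq> - \<infinity>"
  shows "finite {length w | w. params K L w}"
proof -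
  obtain N where N: "\<forall>us. set us \<subseteq> ring_od R \<longrightarrow> N \<le> length us \<longrightarrow> list_prod R us = \<zero>"
    using noetherian_odd_nilpotent[OF assms(1)] ..
  have "length w \<le> N" if w: "params K L w" for w
  proof (rule ccontr)
    assume "\<not> length w \<le> N"
    then have "list_prod R w = \<zero>" using N w by (simp add: params_def)
    then have "prod_image w L \<subseteq> K"
      using assms(3) stableD(2)[OF assms(2)] by (auto simp: prod_image_def subset_iff)
    then show False using w cdim_eq_minus_infinity[OF assms(2)] assms(4) by (simp add: params_def)
  qed
  then have "{length w | w. params K L w} \<subseteq> {..N}" by auto
  then show ?thesis using finite_subset by blast
qed

lemma length_le_max_params:
  assumes "super_noetherian R" "stable K" "L \<subseteq> carrier M" "cdim K L \<noteq> - \<infinity>" "params K L w"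
  shows "length w \<le> max_params K L"
  unfolding max_params_def
  using finite_params_lengths[OF assms(1-4)] assms(5) by (intro Max_ge) auto

text \<open>A nonzero maximum is required because 0 is the inserted default and is not the length of
  any system.\<close>

lemma max_params_attained:
  assumes "super_noetherian R" "stable K" "L \<subseteq> carrier M" "cdim K L \<noteq> - \<infinity>" "max_params K L \<noteq> 0"
  shows "\<exists>w. params K L w \<and> length w = max_params K L"
proof -
  have "max_params K L \<in> insert 0 {length w | w. params K L w}"
    unfolding max_params_def using finite_params_lengths[OF assms(1-4)] by (intro Max_in) auto
  then show ?thesis using assms(5) by auto
qed

subsection \<open>Super-dimensions in terms of colon ideals\<close>

lemma ann_ev_eq: "ann_ev R M = colon {\<zero>\<^bsub>M\<^esub>} (carrier M)"
  by (simp add: ann_ev_def colon_def)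

lemma ann_ev_prod_mod: "ann_ev R (prod_mod R w M) = colon {\<zero>\<^bsub>M\<^esub>} (prod_image w (carrier M))"
  by (simp add: ann_ev_def colon_def prod_mod_def sub_supermod_def prod_image_def)

lemma ann_ev_sub: "ann_ev R (sub_supermod M L) = colon {\<zero>\<^bsub>M\<^esub>} L"
  by (simp add: ann_ev_def colon_def sub_supermod_def)

lemma ann_ev_prod_sub: "ann_ev R (prod_mod R w (sub_supermod M L)) = colon {\<zero>\<^bsub>M\<^esub>} (prod_image w L)"
  by (simp add: ann_ev_def colon_def prod_mod_def sub_supermod_def prod_image_def)

lemma odd_params_eq: "odd_params R M w \<longleftrightarrow> params {\<zero>\<^bsub>M\<^esub>} (carrier M) w"
  by (simp add: odd_params_def params_def sdim0_def cdim_def ann_ev_eq ann_ev_prod_mod)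

lemma sdim1_eq: "sdim1 R M = max_params {\<zero>\<^bsub>M\<^esub>} (carrier M)"
  by (simp add: sdim1_def max_params_def odd_params_eq)

lemma sdim1_sub: "sdim1 R (sub_supermod M L) = max_params {\<zero>\<^bsub>M\<^esub>} L"
  by (simp add: sdim1_def max_params_def odd_params_def params_def sdim0_def cdim_def
      ann_ev_sub ann_ev_prod_sub)

section \<open>Annihilators, parameters and regularity in quotient supermodules\<close>

lemma coset_eq_iff: "stable K \<Longrightarrow> x \<in> carrier M \<Longrightarrow> K +>\<^bsub>M\<^esub> x = K \<longleftrightarrow> x \<in> K"
  unfolding stable_def additive_subgroup_def
  using M.a_coset_join1[of K x] M.a_coset_join2[of x K] subgroup.subset[of K "add_monoid M"] by auto

text \<open>The action on the quotient is a union over all representatives. Since \<open>K\<close>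
  is stable, every member of this union is the same coset.\<close>

lemma smult_coset:
  assumes K: "stable K" and a: "a \<in> carrier R" and x: "x \<in> carrier M"
  shows "a \<odot>\<^bsub>quot_supermod M K\<^esub> (K +>\<^bsub>M\<^esub> x) = K +>\<^bsub>M\<^esub> (a \<odot>\<^bsub>M\<^esub> x)"
proof -
  note Kc = stableD[OF K]
  have "additive_subgroup K M" using K by (simp add: stable_def)
  then interpret K: abelian_subgroup K M by (rule abelian_subgroupI3[OF _ M.abelian_group_axioms])
  have eq: "K +>\<^bsub>M\<^esub> (a \<odot>\<^bsub>M\<^esub> z) = K +>\<^bsub>M\<^esub> (a \<odot>\<^bsub>M\<^esub> x)" if z: "z \<in> K +>\<^bsub>M\<^esub> x" for z
  proof -
    obtain k where k: "k \<in> K" "z = k \<oplus>\<^bsub>M\<^esub> x" using z by (auto simp: a_r_coset_def')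
    have "a \<odot>\<^bsub>M\<^esub> z = a \<odot>\<^bsub>M\<^esub> k \<oplus>\<^bsub>M\<^esub> a \<odot>\<^bsub>M\<^esub> x"
      using subsetD[OF Kc(1) k(1)] a x by (simp add: k(2) smult_r_distr)
    then have "a \<odot>\<^bsub>M\<^esub> z \<in> K +>\<^bsub>M\<^esub> (a \<odot>\<^bsub>M\<^esub> x)" using Kc(5)[OF a k(1)] by (auto simp: a_r_coset_def')
    then show ?thesis using K.a_repr_independence'[of "a \<odot>\<^bsub>M\<^esub> z" "a \<odot>\<^bsub>M\<^esub> x"] a x by simp
  qed
  have "(\<Union>z\<in>K +>\<^bsub>M\<^esub> x. K +>\<^bsub>M\<^esub> (a \<odot>\<^bsub>M\<^esub> z)) = K +>\<^bsub>M\<^esub> (a \<odot>\<^bsub>M\<^esub> x)"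
    by (rule UN_constant_eq[OF K.a_rcos_self[OF x]]) (simp add: eq)
  then show ?thesis by (simp add: quot_supermod_def)
qed

lemma carrier_quot_supermod: "carrier (quot_supermod M K) = (\<lambda>x. K +>\<^bsub>M\<^esub> x) ` carrier M"
  by (auto simp: quot_supermod_def A_RCOSETS_def')

lemma zero_quot_supermod: "\<zero>\<^bsub>quot_supermod M K\<^esub> = K"
  by (simp add: quot_supermod_def)

lemma smult_coset_eq_zero_iff:
  assumes "stable K" "r \<in> ring_ev R" "x \<in> carrier M"
  shows "r \<odot>\<^bsub>quot_supermod M K\<^esub> (K +>\<^bsub>M\<^esub> x) = K \<longleftrightarrow> r \<odot>\<^bsub>M\<^esub> x \<in> K"
proof -
  have r: "r \<in> carrier R" using assms(2) by simp
  show ?thesis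
    unfolding smult_coset[OF assms(1) r assms(3)]
    by (rule coset_eq_iff) (use assms r in simp_all)
qed

lemma ann_ev_quot: "stable K \<Longrightarrow> ann_ev R (quot_supermod M K) = colon K (carrier M)"
  unfolding ann_ev_def colon_def carrier_quot_supermod zero_quot_supermod
  by (intro Collect_cong conj_cong) (simp_all add: smult_coset_eq_zero_iff)

lemma ann_ev_prod_quot:
  assumes "stable K" "set w \<subseteq> ring_od R"
  shows "ann_ev R (prod_mod R w (quot_supermod M K)) = colon K (prod_image w (carrier M))"
proof -
  have c: "carrier (prod_mod R w (quot_supermod M K)) =
      (\<lambda>x. K +>\<^bsub>M\<^esub> (list_prod R w \<odot>\<^bsub>M\<^esub> x)) ` carrier M"
    using assms by (simp add: prod_mod_def sub_supermod_def carrier_quot_supermod image_image smult_coset)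
  have ops: "(\<odot>\<^bsub>prod_mod R w (quot_supermod M K)\<^esub>) = (\<odot>\<^bsub>quot_supermod M K\<^esub>)"
    "\<zero>\<^bsub>prod_mod R w (quot_supermod M K)\<^esub> = K"
    by (simp_all add: prod_mod_def sub_supermod_def zero_quot_supermod)
  show ?thesis
    unfolding ann_ev_def colon_def c ops prod_image_def
    using assms by (intro Collect_cong conj_cong) (simp_all add: smult_coset_eq_zero_iff)
qed

lemma sdim1_quot:
  assumes "stable K"
  shows "sdim1 R (quot_supermod M K) = max_params K (carrier M)"
proof -
  have "odd_params R (quot_supermod M K) w \<longleftrightarrow> params K (carrier M) w" for w
    using assms by (auto simp: odd_params_def params_def sdim0_def cdim_def ann_ev_quot ann_ev_prod_quot)
  then show ?thesis by (simp add: sdim1_def max_params_def)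
qed

text \<open>The inclusion of the kernel in the image, for \<open>y\<close> acting on
  \<open>M/K\<close>, lifted to representatives in \<open>M\<close>.\<close>

lemma odd_regular_quotD:
  assumes K: "stable K" and r: "odd_regular R (quot_supermod M K) y"
    and x: "x \<in> carrier M" "y \<odot>\<^bsub>M\<^esub> x \<in> K"
  shows "\<exists>k m. k \<in> K \<and> m \<in> carrier M \<and> x = k \<oplus>\<^bsub>M\<^esub> y \<odot>\<^bsub>M\<^esub> m"
proof -
  have "additive_subgroup K M" using K by (simp add: stable_def)
  then interpret K: abelian_subgroup K M by (rule abelian_subgroupI3[OF _ M.abelian_group_axioms])
  have y: "y \<in> carrier R" using r by (auto simp: odd_regular_def)
  have "y \<odot>\<^bsub>quot_supermod M K\<^esub> (K +>\<^bsub>M\<^esub> x) = K"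
    using smult_coset[OF K y x(1)] coset_eq_iff[OF K] x y by simp
  then have "K +>\<^bsub>M\<^esub> x \<in> {z \<in> carrier (quot_supermod M K). y \<odot>\<^bsub>quot_supermod M K\<^esub> z = \<zero>\<^bsub>quot_supermod M K\<^esub>}"
    using x by (simp add: carrier_quot_supermod zero_quot_supermod)
  then have "K +>\<^bsub>M\<^esub> x \<in> (\<lambda>z. y \<odot>\<^bsub>quot_supermod M K\<^esub> z) ` carrier (quot_supermod M K)"
    using r unfolding odd_regular_def by blast
  then obtain m where m: "m \<in> carrier M" "K +>\<^bsub>M\<^esub> x = K +>\<^bsub>M\<^esub> (y \<odot>\<^bsub>M\<^esub> m)"
    using smult_coset[OF K y] by (auto simp: carrier_quot_supermod)
  then have "x \<in> K +>\<^bsub>M\<^esub> (y \<odot>\<^bsub>M\<^esub> m)" using K.a_rcos_self[OF x(1)] by simp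
  then show ?thesis using m unfolding a_r_coset_def' by blast
qed

subsection \<open>The submodule generated by odd multiples\<close>

text \<open>This is \<open>I M\<close> for \<open>I = gen_ideal R ys\<close>, as
  \<open>ideal_smult_gen_ideal\<close> shows. Having one summand for each generator makes induction
  along the list possible.\<close>

definition odd_span :: "'a list \<Rightarrow> 'b set" where
  "odd_span ys = {\<Oplus>\<^bsub>M\<^esub>i\<in>{..<length ys}. ys ! i \<odot>\<^bsub>M\<^esub> m i | m. m \<in> {..<length ys} \<rightarrow> carrier M}"

lemma odd_span_Nil [simp]: "odd_span [] = {\<zero>\<^bsub>M\<^esub>}"
  by (auto simp: odd_span_def)

lemma odd_span_snoc:
  assumes "set ys \<subseteq> carrier R" "y \<in> carrier R"
  shows "odd_span (ys @ [y]) = {k \<oplus>\<^bsub>M\<^esub> y \<odot>\<^bsub>M\<^esub> x | k x. k \<in> odd_span ys \<and> x \<in> carrier M}"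
proof -
  let ?n = "length ys"
  have "(ys @ [y]) ! i \<in> carrier R" if "i \<le> ?n" for i
    using that assms by (auto simp: nth_append)
  then have "odd_span (ys @ [y]) =
    {k \<oplus>\<^bsub>M\<^esub> (ys @ [y]) ! ?n \<odot>\<^bsub>M\<^esub> x | k x. k \<in> {\<Oplus>\<^bsub>M\<^esub>i\<in>{..<?n}. (ys @ [y]) ! i \<odot>\<^bsub>M\<^esub> m i | m.
       m \<in> {..<?n} \<rightarrow> carrier M} \<and> x \<in> carrier M}"
    unfolding odd_span_def length_append_singleton by (intro M.finsum_range_Suc) auto
  moreover have "{\<Oplus>\<^bsub>M\<^esub>i\<in>{..<?n}. (ys @ [y]) ! i \<odot>\<^bsub>M\<^esub> m i | m. m \<in> {..<?n} \<rightarrow> carrier M} = odd_span ys"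
  proof -
    have "(\<Oplus>\<^bsub>M\<^esub>i\<in>{..<?n}. (ys @ [y]) ! i \<odot>\<^bsub>M\<^esub> m i) = (\<Oplus>\<^bsub>M\<^esub>i\<in>{..<?n}. ys ! i \<odot>\<^bsub>M\<^esub> m i)"
      if "m \<in> {..<?n} \<rightarrow> carrier M" for m
      by (rule M.finsum_cong') (use that assms in \<open>auto simp: nth_append Pi_iff subset_iff\<close>)
    then show ?thesis unfolding odd_span_def
      by (intro Collect_cong arg_cong[where f = Ex] ext) auto
  qed
  ultimately show ?thesis by simp
qed

text \<open>A scalar in front of \<open>y\<close> can be moved behind it by
  \<open>odd_move_left\<close>, so multiples of \<open>y\<close> are preserved by the whole of
  \<open>R\<close>.\<close>

lemma stable_odd_span:
  assumes "set ys \<subseteq> ring_od R"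
  shows "stable (odd_span ys)"
  using assms
proof (induction ys rule: rev_induct)
  case (snoc y ys)
  have y: "y \<in> ring_od R" "y \<in> carrier R" and ys: "set ys \<subseteq> ring_od R" using snoc.prems by auto
  note J = stableD[OF snoc.IH[OF ys]]
  have JC: "\<And>k. k \<in> odd_span ys \<Longrightarrow> k \<in> carrier M" using J(1) by blast
  have K: "odd_span (ys @ [y]) = {k \<oplus>\<^bsub>M\<^esub> y \<odot>\<^bsub>M\<^esub> x | k x. k \<in> odd_span ys \<and> x \<in> carrier M}"
    using odd_span_snoc ys y by simp
  show ?case
  proof (rule stableI)
    show "odd_span (ys @ [y]) \<subseteq> carrier M" unfolding K using JC y by auto
    have "\<zero>\<^bsub>M\<^esub> = \<zero>\<^bsub>M\<^esub> \<oplus>\<^bsub>M\<^esub> y \<odot>\<^bsub>M\<^esub> \<zero>\<^bsub>M\<^esub>" using y by simp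
    then show "\<zero>\<^bsub>M\<^esub> \<in> odd_span (ys @ [y])" unfolding K using J(2) M.zero_closed by blast
  next
    fix v w assume "v \<in> odd_span (ys @ [y])" "w \<in> odd_span (ys @ [y])"
    then obtain k x l z where vw: "v = k \<oplus>\<^bsub>M\<^esub> y \<odot>\<^bsub>M\<^esub> x" "k \<in> odd_span ys" "x \<in> carrier M"
      "w = l \<oplus>\<^bsub>M\<^esub> y \<odot>\<^bsub>M\<^esub> z" "l \<in> odd_span ys" "z \<in> carrier M" unfolding K by blast
    then have "v \<oplus>\<^bsub>M\<^esub> w = (k \<oplus>\<^bsub>M\<^esub> l) \<oplus>\<^bsub>M\<^esub> y \<odot>\<^bsub>M\<^esub> (x \<oplus>\<^bsub>M\<^esub> z)"
      using y JC by (simp add: smult_r_distr M.a_ac)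
    then show "v \<oplus>\<^bsub>M\<^esub> w \<in> odd_span (ys @ [y])"
      unfolding K using J(3)[OF vw(2,5)] M.a_closed[OF vw(3,6)] by blast
  next
    fix a v assume a: "a \<in> carrier R" and "v \<in> odd_span (ys @ [y])"
    then obtain k x where v: "v = k \<oplus>\<^bsub>M\<^esub> y \<odot>\<^bsub>M\<^esub> x" "k \<in> odd_span ys" "x \<in> carrier M"
      unfolding K by blast
    obtain b where b: "b \<in> carrier R" "a \<otimes> y = y \<otimes> b" using odd_move_left[OF y(1) a] .
    have "a \<odot>\<^bsub>M\<^esub> (y \<odot>\<^bsub>M\<^esub> x) = y \<odot>\<^bsub>M\<^esub> (b \<odot>\<^bsub>M\<^esub> x)"
      using smult_assoc[OF a y(2) v(3)] smult_assoc[OF y(2) b(1) v(3)] b(2) by simp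
    then have "a \<odot>\<^bsub>M\<^esub> v = a \<odot>\<^bsub>M\<^esub> k \<oplus>\<^bsub>M\<^esub> y \<odot>\<^bsub>M\<^esub> (b \<odot>\<^bsub>M\<^esub> x)"
      using v a y JC by (simp add: smult_r_distr)
    then show "a \<odot>\<^bsub>M\<^esub> v \<in> odd_span (ys @ [y])"
      unfolding K using J(5)[OF a v(2)] smult_closed[OF b(1) v(3)] by blast
  qed
qed simp

lemma smult_mem_odd_span:
  assumes "set ys \<subseteq> ring_od R" "y \<in> set ys" "x \<in> carrier M"
  shows "y \<odot>\<^bsub>M\<^esub> x \<in> odd_span ys"
  using assms
proof (induction ys rule: rev_induct)
  case (snoc z ys)
  have z: "z \<in> carrier R" and ys: "set ys \<subseteq> ring_od R" using snoc.prems by auto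
  note J = stableD[OF stable_odd_span[OF ys]]
  have K: "odd_span (ys @ [z]) = {k \<oplus>\<^bsub>M\<^esub> z \<odot>\<^bsub>M\<^esub> x | k x. k \<in> odd_span ys \<and> x \<in> carrier M}"
    using odd_span_snoc ys z by simp
  show ?case
  proof (cases "y = z")
    case True
    have "y \<odot>\<^bsub>M\<^esub> x = \<zero>\<^bsub>M\<^esub> \<oplus>\<^bsub>M\<^esub> z \<odot>\<^bsub>M\<^esub> x" using True z snoc.prems by simp
    then show ?thesis unfolding K using J(2) snoc.prems(3) by blast
  next
    case False
    then have m: "y \<odot>\<^bsub>M\<^esub> x \<in> odd_span ys" using snoc ys by simp
    then have "y \<odot>\<^bsub>M\<^esub> x \<in> carrier M" using J(1) by blast
    then have "y \<odot>\<^bsub>M\<^esub> x = y \<odot>\<^bsub>M\<^esub> x \<oplus>\<^bsub>M\<^esub> z \<odot>\<^bsub>M\<^esub> \<zero>\<^bsub>M\<^esub>" using z by simp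
    then show ?thesis unfolding K using m M.zero_closed by blast
  qed
qed simp

lemma gen_ideal_smult_mem_odd_span:
  assumes "set ys \<subseteq> ring_od R" "a \<in> gen_ideal R ys" "x \<in> carrier M"
  shows "a \<odot>\<^bsub>M\<^esub> x \<in> odd_span ys"
  using assms
proof (induction ys arbitrary: a rule: rev_induct)
  case (snoc y ys)
  have y: "y \<in> ring_od R" "y \<in> carrier R" and ys: "set ys \<subseteq> ring_od R" using snoc.prems by auto
  have a: "a \<in> {k \<oplus> c \<otimes> y | k c. k \<in> gen_ideal R ys \<and> c \<in> carrier R}"
    using gen_ideal_snoc[OF od_carrier[OF ys] y(2)] snoc.prems(2) by simp
  then obtain k c where k: "a = k \<oplus> c \<otimes> y" "k \<in> gen_ideal R ys" "c \<in> carrier R" by blast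
  obtain b where b: "b \<in> carrier R" "c \<otimes> y = y \<otimes> b" using odd_move_left[OF y(1) k(3)] .
  have kc: "k \<in> carrier R" using ideal.Icarr[OF ideal_gen_ideal[OF ys] k(2)] .
  have "a \<odot>\<^bsub>M\<^esub> x = k \<odot>\<^bsub>M\<^esub> x \<oplus>\<^bsub>M\<^esub> y \<odot>\<^bsub>M\<^esub> (b \<odot>\<^bsub>M\<^esub> x)"
    using smult_l_distr[OF kc _ snoc.prems(3)] smult_assoc[OF y(2) b(1) snoc.prems(3)] b y k by simp
  then show ?case
    unfolding odd_span_snoc[OF od_carrier[OF ys] y(2)]
    using snoc.IH[OF ys k(2) snoc.prems(3)] smult_closed[OF b(1) snoc.prems(3)] by blast
qed simp

text \<open>Each summand of an element of \<open>I M\<close> lies in the submodule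
  \<open>odd_span ys\<close>, hence so do all partial sums. Conversely the generators themselves
  belong to \<open>I\<close>.\<close>

lemma ideal_smult_gen_ideal:
  assumes ys: "set ys \<subseteq> ring_od R"
  shows "ideal_smult (gen_ideal R ys) M = odd_span ys"
proof (intro equalityI subsetI)
  fix z assume "z \<in> ideal_smult (gen_ideal R ys) M"
  then obtain n a x where ax: "a \<in> {..<n::nat} \<rightarrow> gen_ideal R ys" "x \<in> {..<n} \<rightarrow> carrier M"
    "z = (\<Oplus>\<^bsub>M\<^esub>k\<in>{..<n}. a k \<odot>\<^bsub>M\<^esub> x k)" unfolding ideal_smult_def by blast
  note J = stableD[OF stable_odd_span[OF ys]]
  have mem: "a k \<odot>\<^bsub>M\<^esub> x k \<in> odd_span ys" if "k < n" for k
    using gen_ideal_smult_mem_odd_span[OF ys, of "a k" "x k"] ax(1,2) that by auto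
  have "(\<Oplus>\<^bsub>M\<^esub>k\<in>{..<j}. a k \<odot>\<^bsub>M\<^esub> x k) \<in> odd_span ys" if "j \<le> n" for j
    using that
  proof (induction j)
    case 0
    then show ?case using J(2) by simp
  next
    case (Suc j)
    have "(\<Oplus>\<^bsub>M\<^esub>k\<in>{..<Suc j}. a k \<odot>\<^bsub>M\<^esub> x k) = a j \<odot>\<^bsub>M\<^esub> x j \<oplus>\<^bsub>M\<^esub> (\<Oplus>\<^bsub>M\<^esub>k\<in>{..<j}. a k \<odot>\<^bsub>M\<^esub> x k)"
      unfolding lessThan_Suc
      by (rule M.finsum_insert) (use mem Suc.prems J(1) in auto)
    then show ?case using J(3)[OF mem[of j] Suc.IH] Suc.prems by simp
  qed
  then show "z \<in> odd_span ys" using ax(3) by simp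
next
  fix z assume "z \<in> odd_span ys"
  then obtain m where "m \<in> {..<length ys} \<rightarrow> carrier M"
    "z = (\<Oplus>\<^bsub>M\<^esub>i\<in>{..<length ys}. ys ! i \<odot>\<^bsub>M\<^esub> m i)" unfolding odd_span_def by blast
  moreover have "(!) ys \<in> {..<length ys} \<rightarrow> gen_ideal R ys"
    using gen_ideal_incl[OF ys] by auto
  ultimately show "z \<in> ideal_smult (gen_ideal R ys) M" unfolding ideal_smult_def by blast
qed

text \<open>The multiplier \<open>u\<close> is arbitrary because the induction shortens
  \<open>ys\<close> while \<open>u\<close> stays fixed; it is later taken to be the product of the
  full list.\<close>

lemma annihilates_odd_span:
  assumes "set ys \<subseteq> ring_od R" "u \<in> carrier R" "\<And>y. y \<in> set ys \<Longrightarrow> u \<otimes> y = \<zero>" "x \<in> odd_span ys"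
  shows "u \<odot>\<^bsub>M\<^esub> x = \<zero>\<^bsub>M\<^esub>"
  using assms
proof (induction ys arbitrary: x rule: rev_induct)
  case (snoc y ys)
  have y: "y \<in> carrier R" and ys: "set ys \<subseteq> ring_od R" using snoc.prems by auto
  have "x \<in> {k \<oplus>\<^bsub>M\<^esub> y \<odot>\<^bsub>M\<^esub> z | k z. k \<in> odd_span ys \<and> z \<in> carrier M}"
    using odd_span_snoc[OF od_carrier[OF ys] y] snoc.prems(4) by simp
  then obtain k z where k: "x = k \<oplus>\<^bsub>M\<^esub> y \<odot>\<^bsub>M\<^esub> z" "k \<in> odd_span ys" "z \<in> carrier M" by blast
  have "k \<in> carrier M" using k(2) stableD(1)[OF stable_odd_span[OF ys]] by blast
  moreover have "u \<odot>\<^bsub>M\<^esub> k = \<zero>\<^bsub>M\<^esub>" using snoc.IH[OF ys snoc.prems(2) _ k(2)] snoc.prems(3) by simp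
  moreover have "u \<odot>\<^bsub>M\<^esub> (y \<odot>\<^bsub>M\<^esub> z) = \<zero>\<^bsub>M\<^esub>"
    using smult_assoc[OF snoc.prems(2) y k(3)] snoc.prems(3)[of y] k(3) by simp
  ultimately show ?case using k y snoc.prems(2) by (simp add: smult_r_distr)
qed simp

lemma list_prod_annihilates_odd_span:
  "set ys \<subseteq> ring_od R \<Longrightarrow> x \<in> odd_span ys \<Longrightarrow> list_prod R ys \<odot>\<^bsub>M\<^esub> x = \<zero>\<^bsub>M\<^esub>"
  by (rule annihilates_odd_span) (auto simp: list_prod_mult_mem)

text \<open>If \<open>r M \<subseteq> N + y M\<close> with \<open>r N \<subseteq> N\<close>, then \<open>r\<^sup>2 M \<subseteq> N + y (N + y M) \<subseteq> N\<close>, since \<open>y\<^sup>2 = 0\<close>.\<close>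

lemma odd_span_radical:
  assumes "set ys \<subseteq> ring_od R" "r \<in> ring_ev R" "\<And>x. x \<in> carrier M \<Longrightarrow> r \<odot>\<^bsub>M\<^esub> x \<in> odd_span ys"
  shows "\<exists>n::nat. \<forall>x\<in>carrier M. (r [^] n) \<odot>\<^bsub>M\<^esub> x = \<zero>\<^bsub>M\<^esub>"
  using assms
proof (induction ys arbitrary: r rule: rev_induct)
  case Nil
  then have "\<forall>x\<in>carrier M. (r [^] (1::nat)) \<odot>\<^bsub>M\<^esub> x = \<zero>\<^bsub>M\<^esub>" by simp
  then show ?case ..
next
  case (snoc y ys)
  have y: "y \<in> ring_od R" "y \<in> carrier R" and ys: "set ys \<subseteq> ring_od R" using snoc.prems by auto
  have r: "r \<in> carrier R" using snoc.prems by simp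
  note J = stableD[OF stable_odd_span[OF ys]]
  have JC: "\<And>k. k \<in> odd_span ys \<Longrightarrow> k \<in> carrier M" using J(1) by blast
  have K: "odd_span (ys @ [y]) = {k \<oplus>\<^bsub>M\<^esub> y \<odot>\<^bsub>M\<^esub> x | k x. k \<in> odd_span ys \<and> x \<in> carrier M}"
    using odd_span_snoc ys y by simp
  have dec: "\<exists>k z. r \<odot>\<^bsub>M\<^esub> x = k \<oplus>\<^bsub>M\<^esub> y \<odot>\<^bsub>M\<^esub> z \<and> k \<in> odd_span ys \<and> z \<in> carrier M" if "x \<in> carrier M" for x
    using snoc.prems(3)[OF that] unfolding K by blast
  have "(r \<otimes> r) \<odot>\<^bsub>M\<^esub> x \<in> odd_span ys" if x: "x \<in> carrier M" for x
  proof -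
    obtain k z where k: "r \<odot>\<^bsub>M\<^esub> x = k \<oplus>\<^bsub>M\<^esub> y \<odot>\<^bsub>M\<^esub> z" "k \<in> odd_span ys" "z \<in> carrier M"
      using dec[OF x] by blast
    obtain l w where l: "r \<odot>\<^bsub>M\<^esub> z = l \<oplus>\<^bsub>M\<^esub> y \<odot>\<^bsub>M\<^esub> w" "l \<in> odd_span ys" "w \<in> carrier M"
      using dec[OF k(3)] by blast
    have yy: "y \<odot>\<^bsub>M\<^esub> (y \<odot>\<^bsub>M\<^esub> w) = \<zero>\<^bsub>M\<^esub>"
      using smult_assoc[OF y(2) y(2) l(3)] od_square[OF y(1)] l(3) by simp
    have ry: "r \<odot>\<^bsub>M\<^esub> (y \<odot>\<^bsub>M\<^esub> z) = y \<odot>\<^bsub>M\<^esub> (r \<odot>\<^bsub>M\<^esub> z)"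
      using smult_ev_commute[of r "[y]" z] snoc.prems(2) y k(3) by simp
    have "(r \<otimes> r) \<odot>\<^bsub>M\<^esub> x = r \<odot>\<^bsub>M\<^esub> k \<oplus>\<^bsub>M\<^esub> y \<odot>\<^bsub>M\<^esub> (l \<oplus>\<^bsub>M\<^esub> y \<odot>\<^bsub>M\<^esub> w)"
      using smult_assoc[OF r r x] smult_r_distr[OF r JC[OF k(2)], of "y \<odot>\<^bsub>M\<^esub> z"] k(1,3) y ry l(1) by simp
    also have "\<dots> = r \<odot>\<^bsub>M\<^esub> k \<oplus>\<^bsub>M\<^esub> y \<odot>\<^bsub>M\<^esub> l"
      using smult_r_distr[OF y(2) JC[OF l(2)], of "y \<odot>\<^bsub>M\<^esub> w"] yy y l(3) JC[OF l(2)] by simp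
    also have "\<dots> \<in> odd_span ys" using J(3)[OF J(5)[OF r k(2)] J(5)[OF y(2) l(2)]] .
    finally show ?thesis .
  qed
  then obtain n :: nat where n: "\<forall>x\<in>carrier M. ((r \<otimes> r) [^] n) \<odot>\<^bsub>M\<^esub> x = \<zero>\<^bsub>M\<^esub>"
    using snoc.IH[OF ys ev_ev[OF snoc.prems(2) snoc.prems(2)]] by blast
  \<comment> \<open>The induction hypothesis was applied to the square of \<open>r\<close>, so each
    generator doubles the exponent.\<close>
  have "r \<otimes> r = r [^] (2::nat)" using r by (simp add: numeral_2_eq_2)
  then have "(r \<otimes> r) [^] n = r [^] (2 * n)" using r by (simp add: R.nat_pow_pow)
  then show ?case using n by metis
qed

text \<open>The two colon ideals have the same radical: one contains the other, and
  \<open>odd_span_radical\<close> supplies the powers.\<close>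

lemma cdim_odd_span:
  assumes "set ys \<subseteq> ring_od R"
  shows "cdim (odd_span ys) (carrier M) = cdim {\<zero>\<^bsub>M\<^esub>} (carrier M)"
proof (rule antisym)
  note S = stable_odd_span[OF assms]
  show "cdim (odd_span ys) (carrier M) \<le> cdim {\<zero>\<^bsub>M\<^esub>} (carrier M)"
    by (rule cdim_mono) (use S stableD(2)[OF S] in auto)
  show "cdim {\<zero>\<^bsub>M\<^esub>} (carrier M) \<le> cdim (odd_span ys) (carrier M)"
    by (rule cdim_mono_radical) (use S odd_span_radical[OF assms] in auto)
qed

lemma prod_image_odd_span:
  assumes "set ys \<subseteq> ring_od R" "ys \<noteq> []" "L \<subseteq> carrier M"
  shows "prod_image ys L \<subseteq> odd_span ys"
proof -
  obtain y ys' where ys: "ys = y # ys'" using assms(2) by (cases ys) auto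
  have "list_prod R ys \<odot>\<^bsub>M\<^esub> x \<in> odd_span ys" if "x \<in> L" for x
  proof -
    have x: "x \<in> carrier M" using that assms(3) by blast
    have c: "y \<in> carrier R" "list_prod R ys' \<in> carrier R" using assms(1) ys by auto
    have "list_prod R ys \<odot>\<^bsub>M\<^esub> x = y \<odot>\<^bsub>M\<^esub> (list_prod R ys' \<odot>\<^bsub>M\<^esub> x)"
      using smult_assoc[OF c x] ys by simp
    also have "\<dots> \<in> odd_span ys"
      using smult_mem_odd_span[OF assms(1), of y] smult_closed[OF c(2) x] ys by simp
    finally show ?thesis .
  qed
  then show ?thesis by (auto simp: prod_image_def)
qed

subsection \<open>Fragments and regular sequences\<close>

text \<open>The longest system is reordered as \<open>ys @ ws\<close>. Every claim then compares a
  module with the image of \<open>M\<close> under this full product, whose dimension is that of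
  \<open>M\<close>.\<close>

lemma fragment_dims:
  assumes noeth: "super_noetherian R" and nz: "carrier M \<noteq> {\<zero>\<^bsub>M\<^esub>}" and ne: "ys \<noteq> []"
    and zs: "params {\<zero>\<^bsub>M\<^esub>} (carrier M) zs" "length zs = max_params {\<zero>\<^bsub>M\<^esub>} (carrier M)"
    and frag: "mset ys \<subseteq># mset zs"
  shows "cdim {\<zero>\<^bsub>M\<^esub>} (odd_span ys) = cdim {\<zero>\<^bsub>M\<^esub>} (carrier M)"
    and "max_params {\<zero>\<^bsub>M\<^esub>} (odd_span ys) \<le> max_params {\<zero>\<^bsub>M\<^esub>} (carrier M)"
    and "max_params {\<zero>\<^bsub>M\<^esub>} (carrier M) \<le> max_params {\<zero>\<^bsub>M\<^esub>} (odd_span ys) + 1"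
    and "max_params {\<zero>\<^bsub>M\<^esub>} (carrier M) \<le> max_params (odd_span ys) (carrier M) + length ys"
proof -
  let ?C = "carrier M" and ?Z = "{\<zero>\<^bsub>M\<^esub>}" and ?S = "odd_span ys"
  obtain X where "mset zs = mset ys + X" using frag by (auto simp: mset_subset_eq_exists_conv)
  moreover obtain ws where "X = mset ws" using ex_mset by metis
  ultimately have mz: "mset zs = mset (ys @ ws)" by simp
  have oz: "set zs \<subseteq> ring_od R" using zs by (simp add: params_def)
  then have "set (ys @ ws) \<subseteq> ring_od R" using mz by (metis set_mset_mset)
  then have oy: "set ys \<subseteq> ring_od R" and ow: "set ws \<subseteq> ring_od R" by auto
  have len: "max_params ?Z ?C = length ys + length ws"
    using mz zs(2) by (metis size_mset length_append)
  note S = stable_odd_span[OF oy]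
  note SC = stableD(1)[OF S]
  have dzs: "cdim ?Z (prod_image zs ?C) = cdim ?Z ?C" using zs by (simp add: params_def)
  have "\<not> ?C \<subseteq> ?Z" using nz by auto
  then have fin: "cdim ?Z ?C \<noteq> - \<infinity>" by (intro cdim_proper) auto
  \<comment> \<open>\<open>I M\<close> lies between the image of \<open>M\<close> under the full
    product and \<open>M\<close>, which have equal dimension.\<close>
  have "cdim ?Z (prod_image zs ?C) = cdim ?Z (prod_image (ys @ ws) ?C)"
    using cdim_prod_image_perm[OF stable_zero subset_refl oz mz] .
  also have "\<dots> \<le> cdim ?Z ?S"
    using prod_image_odd_span[OF oy ne prod_image_closed[OF ow subset_refl]] SC
    by (intro cdim_subset) (simp_all add: prod_image_append[OF oy ow])
  finally show dS: "cdim ?Z ?S = cdim ?Z ?C"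
    using dzs cdim_subset[OF stable_zero SC subset_refl] by simp
  have finS: "cdim ?Z ?S \<noteq> - \<infinity>" using dS fin by simp
  \<comment> \<open>A system for \<open>I M\<close> is one for \<open>M\<close>, since it maps
    \<open>M\<close> onto a set containing its image of \<open>I M\<close>.\<close>
  show "max_params ?Z ?S \<le> max_params ?Z ?C"
  proof (cases "max_params ?Z ?S = 0")
    case False
    then obtain w where w: "params ?Z ?S w" "length w = max_params ?Z ?S"
      using max_params_attained[OF noeth stable_zero SC finS] by blast
    have ow': "set w \<subseteq> ring_od R" using w by (simp add: params_def)
    have "cdim ?Z ?C = cdim ?Z (prod_image w ?S)" using w dS by (simp add: params_def)
    also have "\<dots> \<le> cdim ?Z (prod_image w ?C)"
      by (intro cdim_subset prod_image_mono prod_image_closed SC ow') auto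
    finally have "params ?Z ?C w" using ow' w by (intro paramsI) (auto simp: params_def)
    then have "length w \<le> max_params ?Z ?C"
      by (rule length_le_max_params[OF noeth stable_zero subset_refl fin])
    then show ?thesis using w by simp
  qed simp
  \<comment> \<open>Omit one \<open>y\<close> of \<open>ys\<close> from the longest system. As
    \<open>y M \<subseteq> I M\<close>, the remaining elements form a system for \<open>I M\<close>.
    If nothing remains, the list is not a system, but the bound is trivial.\<close>
  show "max_params ?Z ?C \<le> max_params ?Z ?S + 1"
  proof (cases "length ys + length ws = 1")
    case False
    obtain y ys' where ys: "ys = y # ys'" using ne by (cases ys) auto
    let ?w = "ys' @ ws"
    have w: "set ?w \<subseteq> ring_od R" "?w \<noteq> []" using oy ow ys False by auto
    have y: "set [y] \<subseteq> ring_od R" "y \<in> carrier R" using oy ys by auto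
    have "prod_image [y] ?C \<subseteq> ?S"
      using smult_mem_odd_span[OF oy, of y] ys y by (auto simp: prod_image_def)
    then have "prod_image ?w (prod_image [y] ?C) \<subseteq> prod_image ?w ?S" by (rule prod_image_mono)
    moreover have "prod_image ?w ?S \<subseteq> ?C" by (rule prod_image_closed[OF w(1) SC])
    ultimately have "cdim ?Z (prod_image (?w @ [y]) ?C) \<le> cdim ?Z (prod_image ?w ?S)"
      unfolding prod_image_append[OF w(1) y(1) subset_refl] by (intro cdim_subset) simp_all
    moreover have "cdim ?Z (prod_image zs ?C) = cdim ?Z (prod_image (?w @ [y]) ?C)"
      using mz ys by (intro cdim_prod_image_perm[OF stable_zero subset_refl oz]) simp
    ultimately have "cdim ?Z ?S \<le> cdim ?Z (prod_image ?w ?S)" using dS dzs by simp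
    then have "params ?Z ?S ?w" using w SC by (intro paramsI) auto
    then have "length ?w \<le> max_params ?Z ?S"
      using length_le_max_params[OF noeth stable_zero SC finS] by blast
    then show ?thesis using len ys by simp
  qed (use len in simp)
  \<comment> \<open>The complement \<open>ws\<close> is a system for \<open>M/IM\<close>: if an even
    \<open>r\<close> sends the image of \<open>M\<close> under \<open>ws\<close> into
    \<open>I M\<close>, multiplying by the product of \<open>ys\<close> shows that \<open>r\<close>
    kills the image of \<open>M\<close> under the full product.\<close>
  show "max_params ?Z ?C \<le> max_params ?S ?C + length ys"
  proof (cases "ws = []")
    case False
    have "cdim ?S ?C = cdim ?Z ?C" by (rule cdim_odd_span[OF oy])
    also have "\<dots> = cdim ?Z (prod_image (ys @ ws) ?C)"
      using dzs cdim_prod_image_perm[OF stable_zero subset_refl oz mz] by simp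
    also have "\<dots> \<le> cdim ?S (prod_image ws ?C)"
    proof (rule cdim_mono)
      fix r x assume r: "r \<in> ring_ev R" "\<And>x. x \<in> prod_image ws ?C \<Longrightarrow> r \<odot>\<^bsub>M\<^esub> x \<in> ?S"
        and "x \<in> prod_image (ys @ ws) ?C"
      then obtain z where z: "z \<in> prod_image ws ?C" "x = list_prod R ys \<odot>\<^bsub>M\<^esub> z"
        unfolding prod_image_append[OF oy ow subset_refl] by (auto simp: prod_image_def[of ys])
      have "z \<in> ?C" using z(1) prod_image_closed[OF ow subset_refl] by blast
      then have "r \<odot>\<^bsub>M\<^esub> x = list_prod R ys \<odot>\<^bsub>M\<^esub> (r \<odot>\<^bsub>M\<^esub> z)"
        using smult_ev_commute[OF r(1) oy] z(2) by simp
      then show "r \<odot>\<^bsub>M\<^esub> x \<in> ?Z" using list_prod_annihilates_odd_span[OF oy r(2)[OF z(1)]] by simp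
    next
      show "prod_image ws ?C \<subseteq> ?C" by (rule prod_image_closed[OF ow subset_refl])
      show "prod_image (ys @ ws) ?C \<subseteq> ?C" using oy ow by (intro prod_image_closed) auto
    qed (use S in auto)
    finally have "params ?S ?C ws" using S ow False by (intro paramsI) auto
    moreover have "cdim ?S ?C \<noteq> - \<infinity>" using cdim_odd_span[OF oy] fin by simp
    ultimately have "length ws \<le> max_params ?S ?C"
      using length_le_max_params[OF noeth S subset_refl] by blast
    then show ?thesis using len by simp
  qed (use len in simp)
qed

text \<open>If the product of \<open>ys @ [y]\<close> kills \<open>x\<close>, the product of
  \<open>ys\<close> kills \<open>y x\<close>, which therefore lies in \<open>odd_span ys\<close> by
  induction. Regularity of \<open>y\<close> modulo \<open>odd_span ys\<close> then puts
  \<open>x\<close> into \<open>odd_span ys\<close> plus \<open>y M\<close>.\<close>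

lemma regular_kernel:
  assumes od: "set ys \<subseteq> ring_od R" and reg: "odd_regular_seq R M ys"
    and x: "x \<in> carrier M" "list_prod R ys \<odot>\<^bsub>M\<^esub> x = \<zero>\<^bsub>M\<^esub>"
  shows "x \<in> odd_span ys"
  using assms
proof (induction ys arbitrary: x rule: rev_induct)
  case Nil
  then show ?case using smult_one by simp
next
  case (snoc y ys)
  have y: "y \<in> carrier R" and ys: "set ys \<subseteq> ring_od R" using snoc.prems by auto
  have p: "list_prod R ys \<in> carrier R" using ys by simp
  have reg_ys: "odd_regular_seq R M ys"
    unfolding odd_regular_seq_def
  proof (intro allI impI)
    fix i assume i: "i < length ys"
    then have "odd_regular R (quot_mod M (gen_ideal R (take i (ys @ [y])))) ((ys @ [y]) ! i)"
      using snoc.prems(2) unfolding odd_regular_seq_def by simp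
    then show "odd_regular R (quot_mod M (gen_ideal R (take i ys))) (ys ! i)"
      using i by (simp add: nth_append)
  qed
  have "odd_regular R (quot_mod M (gen_ideal R (take (length ys) (ys @ [y])))) ((ys @ [y]) ! length ys)"
    by (rule snoc.prems(2)[unfolded odd_regular_seq_def, rule_format]) simp
  then have r: "odd_regular R (quot_supermod M (odd_span ys)) y"
    by (simp add: quot_mod_def ideal_smult_gen_ideal[OF ys])
  have "list_prod R (ys @ [y]) = list_prod R ys \<otimes> y"
    using list_prod_append[of ys "[y]"] ys y by simp
  then have "list_prod R ys \<odot>\<^bsub>M\<^esub> (y \<odot>\<^bsub>M\<^esub> x) = \<zero>\<^bsub>M\<^esub>"
    using smult_assoc[OF p y snoc.prems(3)] snoc.prems(4) by simp
  then have "y \<odot>\<^bsub>M\<^esub> x \<in> odd_span ys"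
    using snoc.IH[OF ys reg_ys] smult_closed[OF y snoc.prems(3)] by blast
  then show ?case
    using odd_regular_quotD[OF stable_odd_span[OF ys] r snoc.prems(3)]
    unfolding odd_span_snoc[OF od_carrier[OF ys] y] by blast
qed

section \<open>Regular sequences: comparing \<open>M/IM\<close> with the product image of
  \<open>M\<close>\<close>

context
  fixes ys
  assumes od: "set ys \<subseteq> ring_od R" and reg: "odd_regular_seq R M ys"
begin

lemma regular_mem_odd_span_iff:
  "x \<in> carrier M \<Longrightarrow> x \<in> odd_span ys \<longleftrightarrow> list_prod R ys \<odot>\<^bsub>M\<^esub> x = \<zero>\<^bsub>M\<^esub>"
  using regular_kernel[OF od reg] list_prod_annihilates_odd_span[OF od] by blast

text \<open>\<open>odd_span ys\<close> is the kernel of the product of \<open>ys\<close>, and even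
  scalars commute with that product.\<close>

lemma colon_regular:
  assumes L: "L \<subseteq> carrier M"
  shows "colon (odd_span ys) L = colon {\<zero>\<^bsub>M\<^esub>} (prod_image ys L)"
proof -
  have "r \<odot>\<^bsub>M\<^esub> x \<in> odd_span ys \<longleftrightarrow> r \<odot>\<^bsub>M\<^esub> (list_prod R ys \<odot>\<^bsub>M\<^esub> x) = \<zero>\<^bsub>M\<^esub>"
    if "r \<in> ring_ev R" "x \<in> L" for r x
  proof -
    have x: "x \<in> carrier M" using that L by blast
    have "r \<odot>\<^bsub>M\<^esub> x \<in> carrier M" using that x by simp
    then show ?thesis
      using regular_mem_odd_span_iff smult_ev_commute[OF that(1) od x] by simp
  qed
  then show ?thesis by (auto simp: colon_def prod_image_def)
qed

text \<open>\<open>colon_regular\<close> is applied to the image under \<open>w\<close>. The factors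
  \<open>ys\<close> and \<open>w\<close> then have to be exchanged, which leaves colon ideals
  unchanged.\<close>

lemma params_regular:
  "params (odd_span ys) (carrier M) w \<longleftrightarrow> params {\<zero>\<^bsub>M\<^esub>} (prod_image ys (carrier M)) w"
proof (cases "set w \<subseteq> ring_od R")
  case w: True
  have "colon (odd_span ys) (prod_image w (carrier M)) = colon {\<zero>\<^bsub>M\<^esub>} (prod_image (ys @ w) (carrier M))"
    using colon_regular[OF prod_image_closed[OF w subset_refl]] prod_image_append[OF od w subset_refl]
    by simp
  also have "\<dots> = colon {\<zero>\<^bsub>M\<^esub>} (prod_image (w @ ys) (carrier M))"
    by (rule colon_prod_image_perm) (use od w in auto)
  finally show ?thesis
    using colon_regular[OF subset_refl] prod_image_append[OF w od subset_refl]
    by (simp add: params_def cdim_def)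
qed (simp add: params_def)

lemma max_params_regular:
  "max_params (odd_span ys) (carrier M) = max_params {\<zero>\<^bsub>M\<^esub>} (prod_image ys (carrier M))"
  using params_regular by (simp add: max_params_def)

text \<open>Combined with \<open>cdim_odd_span\<close>, this makes a nonempty regular sequence a
  system of odd parameters of \<open>M\<close>.\<close>

lemma cdim_regular:
  "cdim {\<zero>\<^bsub>M\<^esub>} (prod_image ys (carrier M)) = cdim {\<zero>\<^bsub>M\<^esub>} (carrier M)"
  using colon_regular[OF subset_refl] cdim_odd_span[OF od] by (simp add: cdim_def)

lemma params_append_regular:
  assumes "set w \<subseteq> ring_od R" "w \<noteq> []"
  shows "params {\<zero>\<^bsub>M\<^esub>} (prod_image ys (carrier M)) w \<longleftrightarrow> params {\<zero>\<^bsub>M\<^esub>} (carrier M) (ys @ w)"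
proof -
  have "cdim {\<zero>\<^bsub>M\<^esub>} (prod_image w (prod_image ys (carrier M))) = cdim {\<zero>\<^bsub>M\<^esub>} (prod_image (ys @ w) (carrier M))"
    unfolding prod_image_append[OF assms(1) od subset_refl, symmetric]
    by (rule cdim_prod_image_perm) (use assms od in auto)
  then show ?thesis using assms od cdim_regular by (auto simp: params_def)
qed

text \<open>Systems for the product image correspond to systems for \<open>M\<close> beginning with
  \<open>ys\<close>. Their largest length is thus bounded by that for \<open>M\<close>, with
  equality exactly when some longest system begins with \<open>ys\<close>.\<close>

lemma regular_dims:
  assumes noeth: "super_noetherian R" and nz: "carrier M \<noteq> {\<zero>\<^bsub>M\<^esub>}" and ne: "ys \<noteq> []"
  shows "length ys + max_params {\<zero>\<^bsub>M\<^esub>} (prod_image ys (carrier M)) \<le> max_params {\<zero>\<^bsub>M\<^esub>} (carrier M)"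
    and "length ys + max_params {\<zero>\<^bsub>M\<^esub>} (prod_image ys (carrier M)) = max_params {\<zero>\<^bsub>M\<^esub>} (carrier M) \<longleftrightarrow>
      (\<exists>zs. params {\<zero>\<^bsub>M\<^esub>} (carrier M) (ys @ zs) \<and> length (ys @ zs) = max_params {\<zero>\<^bsub>M\<^esub>} (carrier M))"
      (is "?eq \<longleftrightarrow> ?ext")
proof -
  let ?C = "carrier M" and ?Z = "{\<zero>\<^bsub>M\<^esub>}"
  let ?Y = "prod_image ys ?C"
  have "\<not> ?C \<subseteq> ?Z" using nz by auto
  then have fin: "cdim ?Z ?C \<noteq> - \<infinity>" by (intro cdim_proper) auto
  then have finY: "cdim ?Z ?Y \<noteq> - \<infinity>" using cdim_regular by simp
  have YC: "?Y \<subseteq> ?C" by (rule prod_image_closed[OF od subset_refl])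
  note le = length_le_max_params[OF noeth stable_zero subset_refl fin]
  note leY = length_le_max_params[OF noeth stable_zero YC finY]
  have pys: "params ?Z ?C ys" using od ne cdim_regular by (simp add: params_def)
  \<comment> \<open>When the maximum is the default 0, the empty list serves as \<open>w\<close>,
    because \<open>ys\<close> alone is already a system for \<open>M\<close>.\<close>
  have att: "\<exists>w. params ?Z ?C (ys @ w) \<and> length w = max_params ?Z ?Y"
  proof (cases "max_params ?Z ?Y = 0")
    case True
    then show ?thesis using pys by (intro exI[of _ "[]"]) simp
  next
    case False
    then obtain w where w: "params ?Z ?Y w" "length w = max_params ?Z ?Y"
      using max_params_attained[OF noeth stable_zero YC finY] by blast
    then show ?thesis using params_append_regular[of w] by (auto simp: params_def[of _ _ w])
  qed
  then show bound: "length ys + max_params ?Z ?Y \<le> max_params ?Z ?C" using le by fastforce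
  show "?eq \<longleftrightarrow> ?ext"
  proof
    assume ?eq
    then show ?ext using att by (metis length_append)
  next
    assume ?ext
    then obtain zs where zs: "params ?Z ?C (ys @ zs)" "length (ys @ zs) = max_params ?Z ?C" by blast
    have "length zs \<le> max_params ?Z ?Y"
    proof (cases "zs = []")
      case False
      have "set zs \<subseteq> ring_od R" using zs(1) by (simp add: params_def)
      then show ?thesis using leY params_append_regular[OF _ False] zs(1) by blast
    qed simp
    then show ?eq using zs(2) bound by simp
  qed
qed

end

end

section \<open>Translation of the colon-ideal results into super-dimensions\<close>

theorem proposition2p6:
  fixes R :: "('a, 'm) superring_scheme"
    and M :: "('a, 'b) supermodule"
    and ys :: "'a list"
    and t :: nat
    and I :: "'a set"
  assumes "super_ring R"
    and "super_noetherian R"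
    and "Kdim (even_ring R) < \<infinity>"
    and "super_module R M"
    and "carrier M \<noteq> {\<zero>\<^bsub>M\<^esub>}"
    and "set ys \<subseteq> ring_od R"
    and "t = length ys"
    and "t \<ge> 1"
    and "I = gen_ideal R ys"
  shows
    "(fragment_of_longest R M ys \<longrightarrow>
        sdim0 R M = sdim0 R (ideal_mod I M) \<and>
        sdim0 R (ideal_mod I M) = sdim0 R (quot_mod M I) \<and>
        sdim1 R M \<ge> sdim1 R (ideal_mod I M) \<and>
        int (sdim1 R (ideal_mod I M)) \<ge> int (sdim1 R M) - 1 \<and>
        int (sdim1 R (quot_mod M I)) \<ge> int (sdim1 R M) - int t)
     \<and>
     (odd_regular_seq R M ys \<longrightarrow>
        sdim1 R M \<ge> t \<and>
        sdim1 R (quot_mod M I) = sdim1 R (prod_mod R ys M) \<and>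
        int (sdim1 R (prod_mod R ys M)) \<le> int (sdim1 R M) - int t \<and>
        (int (sdim1 R (quot_mod M I)) = int (sdim1 R M) - int t \<longleftrightarrow>
           (\<exists>zs. longest_odd_params R M (ys @ zs))))"
proof -
  interpret supermod R M
    using assms(4) by (rule supermod.intro)
  let ?C = "carrier M" and ?Z = "{\<zero>\<^bsub>M\<^esub>}" and ?S = "odd_span ys"
  have ne: "ys \<noteq> []" using assms(7,8) by auto
  note od = assms(6)
  note S = stable_odd_span[OF od]
  \<comment> \<open>From here on all three modules are expressed by subsets of \<open>M\<close>, so
    that every super-dimension becomes a \<open>cdim\<close> or a \<open>max_params\<close>.\<close>
  have ideal_mod: "ideal_mod I M = sub_supermod M ?S"
    by (simp add: ideal_mod_def assms(9) ideal_smult_gen_ideal[OF od])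
  have quot_mod: "quot_mod M I = quot_supermod M ?S"
    by (simp add: quot_mod_def assms(9) ideal_smult_gen_ideal[OF od])
  have prod_mod: "prod_mod R ys M = sub_supermod M (prod_image ys ?C)"
    by (simp add: prod_mod_def prod_image_def)
  have s0: "sdim0 R M = cdim ?Z ?C" "sdim0 R (ideal_mod I M) = cdim ?Z ?S"
    "sdim0 R (quot_mod M I) = cdim ?S ?C"
    by (simp_all add: sdim0_def cdim_def ann_ev_eq ideal_mod ann_ev_sub quot_mod ann_ev_quot[OF S])
  have s1: "sdim1 R M = max_params ?Z ?C" "sdim1 R (ideal_mod I M) = max_params ?Z ?S"
    "sdim1 R (quot_mod M I) = max_params ?S ?C"
    "sdim1 R (prod_mod R ys M) = max_params ?Z (prod_image ys ?C)"
    by (simp_all add: sdim1_eq ideal_mod sdim1_sub quot_mod sdim1_quot[OF S] prod_mod)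
  have longest: "longest_odd_params R M w \<longleftrightarrow> params ?Z ?C w \<and> length w = max_params ?Z ?C" for w
    by (simp add: longest_odd_params_def odd_params_eq sdim1_eq)
  show ?thesis
  proof (intro conjI[of "_ \<longrightarrow> _"] impI)
    assume "fragment_of_longest R M ys"
    then obtain zs where zs: "params ?Z ?C zs" "length zs = max_params ?Z ?C" "mset ys \<subseteq># mset zs"
      unfolding fragment_of_longest_def longest by blast
    note d = fragment_dims[OF assms(2,5) ne zs]
    show "sdim0 R M = sdim0 R (ideal_mod I M) \<and>
        sdim0 R (ideal_mod I M) = sdim0 R (quot_mod M I) \<and>
        sdim1 R M \<ge> sdim1 R (ideal_mod I M) \<and>
        int (sdim1 R (ideal_mod I M)) \<ge> int (sdim1 R M) - 1 \<and>
        int (sdim1 R (quot_mod M I)) \<ge> int (sdim1 R M) - int t"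
      unfolding s0 s1 using d cdim_odd_span[OF od] assms(7) by auto
  next
    assume reg: "odd_regular_seq R M ys"
    note d = regular_dims[OF od reg assms(2,5) ne]
    show "sdim1 R M \<ge> t \<and>
        sdim1 R (quot_mod M I) = sdim1 R (prod_mod R ys M) \<and>
        int (sdim1 R (prod_mod R ys M)) \<le> int (sdim1 R M) - int t \<and>
        (int (sdim1 R (quot_mod M I)) = int (sdim1 R M) - int t \<longleftrightarrow>
           (\<exists>zs. longest_odd_params R M (ys @ zs)))"
      \<comment> \<open>Extensibility to a longest system is replaced by the numerical equality of
        \<open>regular_dims\<close>; what remains is arithmetic, with \<open>d(1)\<close> relating
        the natural numbers to the integer differences.\<close>
      unfolding s1 longest max_params_regular[OF od reg] d(2)[symmetric]
      using d(1) assms(7) by auto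
  qed
qed

end
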